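(* Let $F$ be a Fréchet space and let $(f_\alpha)_{\alpha\ge1}$ be a sequence of $F$-valued holomorphic functions on the unit ball $\Delta_n=\{z\in\mathbb{C}^n:\|z\|<1\}$. Let $B\subset\Delta_n$ be a subset such that $\nu(\varrho(B\setminus\{0\}))=0$, where $\nu$ is the invariant measure on the projective space $\mathbb{C}\mathbb{P}^{n-1}$ and $\varrho:\mathbb{C}^n\setminus\{0\}\to\mathbb{C}\mathbb{P}^{n-1}$ is the natural projection. Assume that for some $r_0\in(0,1)$, for each complex line $\ell$ through $0$ with $\ell\cap B\subset\{0\}$, the restriction of the sequence $(f_\alpha)_{\alpha\ge1}$ to $\ell$ is convergent in the disk $\{z\in\ell:\|z\|<r_0\}$. Then $(f_\alpha)_{\alpha\ge1}$ is a sequence of holomorphic functions which converges on a neighbourhood of $0$ in $\Delta_n$.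
   Context: A Fréchet space is a complete metrizable locally convex Hausdorff space (here over $\mathbb{C}$). The invariant measure on $\mathbb{C}\mathbb{P}^{n-1}$ is the one invariant under the unitary group. Convergence of a sequence of holomorphic functions on an open set means uniform convergence on compact subsets. *)

theory Defs
  imports "HOL-Analysis.Analysis" "HOL-Probability.Probability_Measure"
begin

subsection \<open>Complex Frechet spaces\<close>

class complex_vector = real_vector +
  fixes scaleC :: "complex \<Rightarrow> 'a \<Rightarrow> 'a" (infixr "*\<^sub>C" 75)
  assumes scaleC_add_right: "c *\<^sub>C (x + y) = c *\<^sub>C x + c *\<^sub>C y"
    and scaleC_add_left: "(c + d) *\<^sub>C x = c *\<^sub>C x + d *\<^sub>C x"
    and scaleC_scaleC: "c *\<^sub>C d *\<^sub>C x = (c * d) *\<^sub>C x"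
    and scaleC_one: "1 *\<^sub>C x = x"
    and scaleR_scaleC: "r *\<^sub>R x = complex_of_real r *\<^sub>C x"

text \<open>The class \<open>uniform_topological_group_add\<close> forces the uniformity of the type to be the
  canonical one, generated by the sets \<open>{(x, y). y - x \<in> U}\<close> for neighbourhoods \<open>U\<close> of \<open>0\<close>, so
  completeness and uniform convergence are those of the underlying topological vector space. The
  library constants \<open>convex\<close> and \<open>euclidean\<close> cannot be used inside a class declaration; they are
  unfolded in \<open>locally_convex\<close> and \<open>metrizable\<close>.\<close>

class frechet_space = complex_vector + uniform_topological_group_add + complete_uniform_space +
  t2_space +
  assumes tendsto_scaleC_Pair:
      "((\<lambda>p. fst p *\<^sub>C snd p) \<longlongrightarrow> c *\<^sub>C x) (nhds c \<times>\<^sub>F nhds x)"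
    and locally_convex:
      "open U \<Longrightarrow> 0 \<in> U \<Longrightarrow>
         \<exists>V. open V \<and> 0 \<in> V \<and> V \<subseteq> U \<and>
             (\<forall>x\<in>V. \<forall>y\<in>V. \<forall>u\<ge>0. \<forall>v\<ge>0. u + v = 1 \<longrightarrow> u *\<^sub>R x + v *\<^sub>R y \<in> V)"
    and metrizable: "metrizable_space (topology open)"

text \<open>A map into a Frechet space on an open subset \<open>D\<close> of complex \<open>n\<close>-space is holomorphic if it is
  continuous and complex differentiable along every complex direction.\<close>

definition vholomorphic_on :: "(complex ^ 'n \<Rightarrow> 'f::frechet_space) \<Rightarrow> (complex ^ 'n) set \<Rightarrow> bool"
    (infixl "vholomorphic'_on" 50) where
  "f vholomorphic_on D \<longleftrightarrow> continuous_on D f \<and>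
     (\<forall>z\<in>D. \<forall>v. \<exists>d. ((\<lambda>t. inverse t *\<^sub>C (f (z + t *s v) - f z)) \<longlongrightarrow> d) (at 0))"

text \<open>The library's \<open>uniform_limit\<close> is restricted to metric codomains. \<open>S\<close> will be an open set or an
  open disc in a complex line.\<close>

definition convergent_uniformly_on_compacts ::
    "(nat \<Rightarrow> 'a::topological_space \<Rightarrow> 'f::uniform_space) \<Rightarrow> 'a set \<Rightarrow> bool" where
  "convergent_uniformly_on_compacts f S \<longleftrightarrow>
     (\<exists>g. \<forall>K. compact K \<longrightarrow> K \<subseteq> S \<longrightarrow>
        (\<forall>E. eventually E uniformity \<longrightarrow> (\<forall>\<^sub>F k in sequentially. \<forall>z\<in>K. E (f k z, g z))))"


subsection \<open>Complex projective space and its invariant measure\<close>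

definition cline :: "complex ^ 'n \<Rightarrow> (complex ^ 'n) set" where
  "cline z = range (\<lambda>c. c *s z)"

text \<open>The points are the complex lines through \<open>0\<close>; the dimension is \<open>CARD('n) - 1\<close>.\<close>

typedef (overloaded) ('n::finite) cproj = "cline ` (- {0 :: complex ^ 'n})"
  by (rule exI[of _ "cline (1 :: complex ^ 'n)"]) simp

definition cproj_of :: "complex ^ 'n \<Rightarrow> 'n cproj" where
  "cproj_of z = Abs_cproj (cline z)"

text \<open>The quotient topology with respect to \<open>cproj_of\<close> on the nonzero vectors; the Borel sets of
  projective space refer to it.\<close>

instantiation cproj :: (finite) topological_space
begin

definition open_cproj :: "'a cproj set \<Rightarrow> bool" where
  "open_cproj U \<longleftrightarrow> open {z. z \<noteq> 0 \<and> cproj_of z \<in> U}"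

instance
proof
  have "{z::complex ^ 'a. z \<noteq> 0 \<and> cproj_of z \<in> UNIV} = - {0}" by auto
  then show "open (UNIV :: 'a cproj set)"
    by (simp add: open_cproj_def open_Compl)
next
  fix S T :: "'a cproj set"
  assume "open S" "open T"
  then have "open ({z. z \<noteq> 0 \<and> cproj_of z \<in> S} \<inter> {z. z \<noteq> 0 \<and> cproj_of z \<in> T})"
    unfolding open_cproj_def by (rule open_Int)
  moreover have "{z. z \<noteq> 0 \<and> cproj_of z \<in> S} \<inter> {z. z \<noteq> 0 \<and> cproj_of z \<in> T} =
      {z. z \<noteq> 0 \<and> cproj_of z \<in> S \<inter> T}" by auto
  ultimately show "open (S \<inter> T)"
    by (simp only: open_cproj_def)
next
  fix K :: "'a cproj set set"
  assume "\<forall>S\<in>K. open S"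
  then have "open (\<Union>S\<in>K. {z. z \<noteq> 0 \<and> cproj_of z \<in> S})"
    unfolding open_cproj_def by (rule open_UN)
  moreover have "(\<Union>S\<in>K. {z. z \<noteq> 0 \<and> cproj_of z \<in> S}) = {z. z \<noteq> 0 \<and> cproj_of z \<in> \<Union>K}"
    by auto
  ultimately show "open (\<Union>K)"
    by (simp only: open_cproj_def)
qed

end

definition unitary_matrix :: "complex ^ 'n ^ 'n \<Rightarrow> bool" where
  "unitary_matrix A \<longleftrightarrow> map_matrix cnj (transpose A) ** A = mat 1"

definition cproj_act :: "complex ^ 'n ^ 'n \<Rightarrow> 'n cproj \<Rightarrow> 'n cproj" where
  "cproj_act A l = Abs_cproj ((*v) A ` Rep_cproj l)"

text \<open>The invariant measure is unique up to a positive factor; it is normalised to total mass \<open>1\<close>,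
  which does not affect its null sets.\<close>

definition cproj_invariant_measure :: "'n::finite cproj measure \<Rightarrow> bool" where
  "cproj_invariant_measure \<nu> \<longleftrightarrow> prob_space \<nu> \<and> sets \<nu> = sets borel \<and>
     (\<forall>A. unitary_matrix A \<longrightarrow> distr \<nu> borel (cproj_act A) = \<nu>)"

end

theory Submission
  imports Defs "HOL-Complex_Analysis.Complex_Analysis"
    "HOL-Computational_Algebra.Fundamental_Theorem_Algebra"
begin

text \<open>
  Expand a holomorphic function on the ball into homogeneous parts, which are polynomials of degree
  \<open>k\<close> on every affine line. Suppose that the function is bounded by \<open>1\<close> on the discs through a set \<open>E\<close>
  of points that fills a small ball up to a set of small Lebesgue measure. By the Cauchy estimates all
  its homogeneous parts are then bounded by \<open>1\<close> on \<open>E\<close>. A Remez inequality shows that a polynomial of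
  degree \<open>k\<close> that is bounded by \<open>1\<close> on a set of measure at least \<open>1/4\<close> in the unit interval is bounded by
  \<open>625 ^ k\<close> at \<open>0\<close> (\<open>Remez_at_zero\<close>). Hence the homogeneous parts grow at most geometrically
  everywhere, and the function is bounded by \<open>2\<close> on a ball whose radius depends neither on the function
  nor on \<open>E\<close> (\<open>bounded_near_zero_of_bounded_on_large_circled_set\<close>).

  This is applied to the differences \<open>f \<alpha> - f \<beta>\<close>, composed with continuous functionals. As the sequence
  converges on almost every line, an Egorov argument finds, for every neighbourhood \<open>U\<close> of \<open>0\<close> in the
  Frechet space, a number \<open>N\<close> such that the differences with \<open>\<alpha>, \<beta> \<ge> N\<close> are small on the discs through a
  set \<open>E\<close> as above. So they are small on one fixed ball, for every \<open>U\<close>: the sequence is uniformly Cauchy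
  there (\<open>uniformly_small_near_zero\<close>), and completeness gives the limit. That the radius does not shrink
  with \<open>U\<close> is the point of having an estimate that depends on the measure of \<open>E\<close> alone.

  Two ingredients come from outside function theory. The Hahn--Banach theorem replaces neighbourhoods in
  the Frechet space by families of functionals (\<open>neighbourhood_polar\<close>). And the hypothesis on the
  exceptional set concerns an invariant measure on projective space, known only through its
  invariance; averaging over Householder reflections shows that the cone over a null set is
  Lebesgue null (\<open>null_cone_of_invariant_null\<close>).
\<close>

section \<open>Functionals on Frechet spaces\<close>

definition sublinear :: "('a::real_vector \<Rightarrow> real) \<Rightarrow> bool" where
  "sublinear p \<longleftrightarrow> (\<forall>x y. p (x + y) \<le> p x + p y) \<and> (\<forall>t>0. \<forall>x. p (t *\<^sub>R x) = t * p x)"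

lemma sublinear_zero: "sublinear p \<Longrightarrow> p 0 = 0"
proof -
  assume "sublinear p"
  then have "p (2 *\<^sub>R 0) = 2 * p 0" unfolding sublinear_def by (metis zero_less_numeral)
  then show ?thesis by simp
qed

lemma sublinear_ge_neg: "sublinear p \<Longrightarrow> - p (- x) \<le> p x"
  using sublinear_zero[of p] unfolding sublinear_def
  by (metis add.commute add_0 add_uminus_conv_diff diff_0 diff_le_eq right_minus_eq)

text \<open>The infimum of \<open>p (x + t *\<^sub>R y) - t * p y\<close> over \<open>t \<ge> 0\<close> is again sublinear and lies below \<open>p\<close>
  (take \<open>t = 0\<close>); at \<open>- y\<close>, the choice \<open>t = 1\<close> bounds it by \<open>- p y\<close>. This one construction
  serves twice: it prescribes the value of the functional at a given point, and it shows that a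
  minimal sublinear functional is odd, hence linear.\<close>

lemma sublinear_pull_down:
  assumes p: "sublinear p"
  obtains p' where "sublinear p'" "\<And>x. p' x \<le> p x" "p' (- y) \<le> - p y"
proof
  define g where "g x t = p (x + t *\<^sub>R y) - t * p y" for x t
  define p' where "p' x = (INF t\<in>{0..}. g x t)" for x
  have add: "p (x + z) \<le> p x + p z" for x z using p by (auto simp: sublinear_def)
  have sc: "p (t *\<^sub>R x) = t * p x" if "t \<ge> 0" for x t
    using p that sublinear_zero[OF p] by (cases "t = 0") (auto simp: sublinear_def)
  have lb: "- p (- x) \<le> g x t" if "t \<ge> 0" for x t
    using add[of "x + t *\<^sub>R y" "- x"] sc[OF that, of y] by (simp add: g_def)
  have bdd: "bdd_below (g x ` {0..})" for x
    by (rule bdd_belowI2[of _ "- p (- x)"]) (use lb in auto)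
  have le: "p' x \<le> g x t" if "t \<ge> 0" for x t
    unfolding p'_def by (rule cINF_lower[OF bdd]) (use that in auto)
  have ge: "m \<le> p' x" if "\<And>t. t \<ge> 0 \<Longrightarrow> m \<le> g x t" for m x
    unfolding p'_def by (rule cINF_greatest) (use that in auto)
  show "p' x \<le> p x" for x using le[of 0 x] by (simp add: g_def)
  show "p' (- y) \<le> - p y" using le[of 1 "- y"] sublinear_zero[OF p] by (simp add: g_def)
  have sub: "p' (x + z) \<le> p' x + p' z" for x z
  proof -
    have "p' (x + z) \<le> g x s + g z t" if "s \<ge> 0" "t \<ge> 0" for s t
    proof -
      have "p' (x + z) \<le> g (x + z) (s + t)" using that by (intro le) auto
      also have "\<dots> \<le> g x s + g z t"
        using add[of "x + s *\<^sub>R y" "z + t *\<^sub>R y"] by (simp add: g_def algebra_simps)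
      finally show ?thesis .
    qed
    then have "p' (x + z) - g z t \<le> p' x" if "t \<ge> 0" for t
      using that by (intro ge) (simp add: algebra_simps)
    then have "p' (x + z) - p' x \<le> p' z" 
      by (intro ge) (simp add: algebra_simps)
    then show ?thesis by simp
  qed
  have half: "p' (t *\<^sub>R x) \<ge> t * p' x" if "t > 0" for t x
  proof (rule ge)
    fix s :: real assume "s \<ge> 0"
    have "g (t *\<^sub>R x) s = t * g x (s / t)"
    proof -
      have "p (t *\<^sub>R x + s *\<^sub>R y) = t * p (x + (s / t) *\<^sub>R y)"
        using sc[of t "x + (s / t) *\<^sub>R y"] that by (simp add: algebra_simps)
      then show ?thesis using that by (simp add: g_def algebra_simps)
    qed
    then show "t * p' x \<le> g (t *\<^sub>R x) s"
      using le[of "s / t" x] that \<open>s \<ge> 0\<close> by simp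
  qed
  have "p' (t *\<^sub>R x) = t * p' x" if "t > 0" for t x
  proof (rule antisym)
    show "p' (t *\<^sub>R x) \<le> t * p' x"
      using half[of "1 / t" "t *\<^sub>R x"] that by (simp add: field_simps)
  qed (use half that in auto)
  then show "sublinear p'" using sub by (auto simp: sublinear_def)
qed

text \<open>All members of the chain lie above \<open>\<lambda>x. - q (- x)\<close>, so the pointwise infimum is finite; since
  two members can always be replaced by the smaller one, subadditivity survives.\<close>

lemma chain_Inf_sublinear:
  assumes C: "\<And>a. a \<in> C \<Longrightarrow> sublinear a \<and> (\<forall>x. a x \<le> q x)" "C \<noteq> {}"
    and q: "sublinear q"
    and ch: "\<And>a b. a \<in> C \<Longrightarrow> b \<in> C \<Longrightarrow> (\<forall>x. a x \<le> b x) \<or> (\<forall>x. b x \<le> a x)"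
  shows "sublinear (\<lambda>x. INF a\<in>C. a x)" "\<And>a x. a \<in> C \<Longrightarrow> (INF a\<in>C. a x) \<le> a x"
proof -
  have bdd: "bdd_below ((\<lambda>a. a x) ` C)" for x
  proof (rule bdd_belowI2)
    fix a assume "a \<in> C"
    then show "- q (- x) \<le> a x"
      using C(1)[of a] sublinear_ge_neg[of a x] by (smt (verit))
  qed
  let ?m = "\<lambda>x. INF a\<in>C. a x"
  show le: "?m x \<le> a x" if "a \<in> C" for a x
    by (rule cINF_lower[OF bdd that])
  have ge: "m \<le> ?m x" if "\<And>a. a \<in> C \<Longrightarrow> m \<le> a x" for m x
    by (rule cINF_greatest) (use that C in auto)
  have sub: "?m (x + z) \<le> ?m x + ?m z" for x z
  proof -
    have "?m (x + z) \<le> a x + b z" if "a \<in> C" "b \<in> C" for a b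
    proof -
      have "\<exists>c\<in>C. c x \<le> a x \<and> c z \<le> b z"
        using ch[OF that] that by blast
      then obtain c where c: "c \<in> C" "c x \<le> a x" "c z \<le> b z" by blast
      have "?m (x + z) \<le> c (x + z)" using c by (intro le)
      also have "\<dots> \<le> c x + c z" using C(1)[OF c(1)] by (auto simp: sublinear_def)
      finally show ?thesis using c by simp
    qed
    then have "?m (x + z) - b z \<le> ?m x" if "b \<in> C" for b
      using that by (intro ge) (simp add: algebra_simps)
    then have "?m (x + z) - ?m x \<le> ?m z" by (intro ge) (simp add: algebra_simps)
    then show ?thesis by simp
  qed
  have half: "?m (t *\<^sub>R x) \<ge> t * ?m x" if "t > 0" for t x
  proof (rule ge)
    fix a assume a: "a \<in> C"
    have "a (t *\<^sub>R x) = t * a x" using C(1)[OF a] that by (auto simp: sublinear_def)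
    then show "t * ?m x \<le> a (t *\<^sub>R x)" using le[OF a, of x] that by simp
  qed
  have "?m (t *\<^sub>R x) = t * ?m x" if "t > 0" for t x
  proof (rule antisym)
    show "?m (t *\<^sub>R x) \<le> t * ?m x"
      using half[of "1 / t" "t *\<^sub>R x"] that by (simp add: field_simps)
  qed (use half that in auto)
  then show "sublinear ?m" using sub by (auto simp: sublinear_def)
qed

text \<open>Pull \<open>q\<close> down at \<open>y\<close> to a sublinear \<open>q'\<close> and take, by Zorn's lemma, a minimal sublinear
  functional \<open>m\<close> below \<open>q'\<close>. Pulling \<open>m\<close> down at any point changes nothing, so \<open>m\<close> is odd, and an
  odd sublinear functional is linear. It takes the value \<open>q y\<close> at \<open>y\<close> because \<open>q' (- y) \<le> - q y\<close>.\<close>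

theorem Hahn_Banach_sublinear:
  fixes q :: "'a::real_vector \<Rightarrow> real"
  assumes q: "sublinear q"
  obtains u where "linear u" "\<And>x. u x \<le> q x" "u y = q y"
proof -
  obtain q' where q': "sublinear q'" "\<And>x. q' x \<le> q x" "q' (- y) \<le> - q y"
    using sublinear_pull_down[OF q] by metis
  define A where "A = {p. sublinear p \<and> (\<forall>x. p x \<le> q' x)}"
  define P :: "('a \<Rightarrow> real) \<Rightarrow> ('a \<Rightarrow> real) \<Rightarrow> bool" where "P a b \<longleftrightarrow> (\<forall>x. b x \<le> a x)" for a b
  have "\<exists>m\<in>A. \<forall>a\<in>A. P m a \<longrightarrow> a = m"
  proof (rule predicate_Zorn)
    show "partial_order_on A (relation_of P A)"
    proof (rule partial_order_on_relation_ofI)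
      show "P a c" if "P a b" "P b c" for a b c using that unfolding P_def by (meson order_trans)
      show "a = b" if "P a b" "P b a" for a b using that unfolding P_def by (simp add: antisym fun_eq_iff)
    qed (simp add: P_def)
  next
    fix C assume C: "C \<in> Chains (relation_of P A)"
    show "\<exists>u\<in>A. \<forall>a\<in>C. P a u"
    proof (cases "C = {}")
      case True then show ?thesis using q' by (intro bexI[of _ q']) (auto simp: A_def)
    next
      case False
      have CA: "a \<in> A" if "a \<in> C" for a
        using C that by (auto simp: Chains_def relation_of_def)
      have "(\<forall>x. a x \<le> b x) \<or> (\<forall>x. b x \<le> a x)" if "a \<in> C" "b \<in> C" for a b
        using C that by (auto simp: Chains_def relation_of_def P_def)
      note chain = this
      have le_q': "sublinear a \<and> (\<forall>x. a x \<le> q' x)" if "a \<in> C" for a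
        using CA[OF that] by (simp add: A_def)
      have s: "sublinear (\<lambda>x. INF a\<in>C. a x)"
        by (rule chain_Inf_sublinear(1)[OF _ False q'(1)]) (use le_q' chain in blast)+
      have l: "(INF a\<in>C. a x) \<le> a x" if "a \<in> C" for a x
        by (rule chain_Inf_sublinear(2)[OF _ False q'(1) _ that]) (use le_q' chain in blast)+
      obtain a0 where "a0 \<in> C" using False by auto
      then have "(INF a\<in>C. a x) \<le> q' x" for x
        using l[of a0 x] CA[of a0] unfolding A_def by (smt (verit) mem_Collect_eq)
      then show ?thesis using s l by (intro bexI[of _ "\<lambda>x. INF a\<in>C. a x"]) (auto simp: A_def P_def)
    qed
  qed
  then obtain m where m: "m \<in> A" and min: "\<And>a. a \<in> A \<Longrightarrow> (\<And>x. a x \<le> m x) \<Longrightarrow> a = m"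
    by (auto simp: P_def)
  have ms: "sublinear m" and mq: "\<And>x. m x \<le> q' x" using m by (auto simp: A_def)
  have odd: "m (- z) = - m z" for z
  proof -
    obtain p' where p': "sublinear p'" "\<And>x. p' x \<le> m x" "p' (- z) \<le> - m z"
      using sublinear_pull_down[OF ms] by metis
    then have "p' \<in> A" using mq unfolding A_def by (smt (verit) mem_Collect_eq)
    then have "p' = m" using min p' by blast
    then show ?thesis using p' sublinear_ge_neg[OF ms, of "- z"] by auto
  qed
  have "linear m"
  proof (rule linearI)
    show "m (x + z) = m x + m z" for x z
    proof (rule antisym)
      show "m (x + z) \<le> m x + m z" using ms by (auto simp: sublinear_def)
      have "m (- x + - z) \<le> m (- x) + m (- z)" using ms unfolding sublinear_def by blast
      then show "m x + m z \<le> m (x + z)" using odd[of "x + z"] by (simp add: odd)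
    qed
    show "m (t *\<^sub>R x) = t *\<^sub>R m x" for t x
    proof (cases "t > 0")
      case True then show ?thesis using ms by (auto simp: sublinear_def)
    next
      case False
      show ?thesis
      proof (cases "t = 0")
        case False
        then have "m ((- t) *\<^sub>R x) = (- t) * m x"
          using \<open>\<not> t > 0\<close> ms unfolding sublinear_def
          by (metis less_le_not_le linorder_not_less neg_0_less_iff_less nle_le order_less_le)
        then show ?thesis using odd[of "t *\<^sub>R x"] by simp
      qed (use sublinear_zero[OF ms] in auto)
    qed
  qed
  moreover have "m x \<le> q x" for x using mq q'(2) order_trans by blast
  moreover have "m y = q y"
    using mq[of "- y"] q'(3) odd[of y] \<open>m y \<le> q y\<close> by simp
  ultimately show ?thesis using that by blast
qed

text \<open>Apply the Hahn--Banach theorem to the Minkowski gauge of \<open>V\<close>: it is at most \<open>1\<close> on \<open>V\<close> and at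
  least \<open>1\<close> at the point \<open>y\<close> outside \<open>V\<close>.\<close>

theorem separate_point_from_convex:
  fixes V :: "'a::real_vector set"
  assumes "convex V" and absorb: "\<And>x. \<exists>t>0. t *\<^sub>R x \<in> V" and "y \<notin> V"
  obtains u where "linear u" "\<And>x. x \<in> V \<Longrightarrow> u x \<le> 1" "u y \<ge> (1::real)"
proof -
  have zV: "0 \<in> V" using absorb[of 0] by auto
  define S where "S x = {t. t > 0 \<and> inverse t *\<^sub>R x \<in> V}" for x
  define q where "q x = Inf (S x)" for x
  have bdd: "bdd_below (S x)" for x by (rule bdd_belowI[of _ 0]) (auto simp: S_def)
  have ne: "S x \<noteq> {}" for x
  proof -
    obtain t where "t > 0" "t *\<^sub>R x \<in> V" using absorb by blast
    then have "inverse t \<in> S x" by (auto simp: S_def)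
    then show ?thesis by auto
  qed
  have le: "q x \<le> t" if "t \<in> S x" for x t unfolding q_def by (rule cInf_lower[OF that bdd])
  have ge: "m \<le> q x" if "\<And>t. t \<in> S x \<Longrightarrow> m \<le> t" for m x
    unfolding q_def by (rule cInf_greatest[OF ne that])
  have add: "q (x + z) \<le> q x + q z" for x z
  proof -
    have "q (x + z) \<le> s + t" if "s \<in> S x" "t \<in> S z" for s t
    proof (rule le)
      have st: "s > 0" "t > 0" "inverse s *\<^sub>R x \<in> V" "inverse t *\<^sub>R z \<in> V" 
        using that by (auto simp: S_def)
      have "(s / (s + t)) *\<^sub>R (inverse s *\<^sub>R x) + (t / (s + t)) *\<^sub>R (inverse t *\<^sub>R z) \<in> V"
        using st by (intro convexD[OF \<open>convex V\<close>]) (auto simp flip: add_divide_distrib)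
      moreover have "(s / (s + t)) *\<^sub>R (inverse s *\<^sub>R x) + (t / (s + t)) *\<^sub>R (inverse t *\<^sub>R z)
          = inverse (s + t) *\<^sub>R (x + z)"
        using st by (simp add: scaleR_add_right field_simps)
      ultimately show "s + t \<in> S (x + z)" using st by (auto simp: S_def)
    qed
    then have "q (x + z) - t \<le> q x" if "t \<in> S z" for t
      using that by (intro ge) (simp add: algebra_simps)
    then have "q (x + z) - q x \<le> q z" by (intro ge) (simp add: algebra_simps)
    then show ?thesis by simp
  qed
  have half: "q (t *\<^sub>R x) \<ge> t * q x" if "t > 0" for t x
  proof (rule ge)
    fix s assume "s \<in> S (t *\<^sub>R x)"
    then have "s / t \<in> S x" using that by (auto simp: S_def field_simps)
    from le[OF this] show "t * q x \<le> s" using that by (simp add: field_simps)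
  qed
  have "q (t *\<^sub>R x) = t * q x" if "t > 0" for t x
  proof (rule antisym)
    show "q (t *\<^sub>R x) \<le> t * q x"
      using half[of "1 / t" "t *\<^sub>R x"] that by (simp add: field_simps)
  qed (use half that in auto)
  with add have "sublinear q" by (auto simp: sublinear_def)
  then obtain u where u: "linear u" "\<And>x. u x \<le> q x" "u y = q y"
    using Hahn_Banach_sublinear by metis
  have "q x \<le> 1" if "x \<in> V" for x by (rule le) (use that in \<open>auto simp: S_def\<close>)
  moreover have "1 \<le> q y"
  proof (rule ge)
    fix t assume t: "t \<in> S y"
    show "1 \<le> t"
    proof (rule ccontr)
      assume "\<not> 1 \<le> t"
      then have "t *\<^sub>R (inverse t *\<^sub>R y) + (1 - t) *\<^sub>R 0 \<in> V"
        using t zV by (intro convexD[OF \<open>convex V\<close>]) (auto simp: S_def)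
      then show False using t \<open>y \<notin> V\<close> by (auto simp: S_def)
    qed
  qed
  ultimately show ?thesis using that u by (metis order_trans)
qed

lemma scaleC_zero_right: "c *\<^sub>C (0::'f::frechet_space) = 0"
  using scaleC_add_right[of c "0::'f" 0] by simp

lemma continuous_scaleC: "continuous_on UNIV (\<lambda>x::'f::frechet_space. c *\<^sub>C x)"
  unfolding continuous_on_def
proof
  fix x :: 'f
  have "filterlim (\<lambda>y. (c, y)) (nhds c \<times>\<^sub>F nhds x) (nhds x)"
    by (intro filterlim_Pair tendsto_const filterlim_ident)
  from filterlim_compose[OF tendsto_scaleC_Pair this]
  show "((\<lambda>y. c *\<^sub>C y) \<longlongrightarrow> c *\<^sub>C x) (at x within UNIV)"
    by (auto intro: tendsto_mono[OF at_within_le_nhds])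
qed

lemma tendsto_scaleC_zero:
  "((\<lambda>c. c *\<^sub>C (x::'f::frechet_space)) \<longlongrightarrow> 0) (nhds 0)"
proof -
  have "filterlim (\<lambda>c. (c, x)) (nhds 0 \<times>\<^sub>F nhds x) (nhds 0)"
    by (intro filterlim_Pair tendsto_const filterlim_ident)
  from filterlim_compose[OF tendsto_scaleC_Pair this]
  have "((\<lambda>c. c *\<^sub>C x) \<longlongrightarrow> 0 *\<^sub>C x) (nhds 0)" by simp
  moreover have "0 *\<^sub>C x = 0" using scaleR_scaleC[of 0 x] by simp
  ultimately show ?thesis by simp
qed

definition clinear_functional :: "('f::frechet_space \<Rightarrow> complex) \<Rightarrow> bool" where
  "clinear_functional \<phi> \<longleftrightarrow> (\<forall>x y. \<phi> (x + y) = \<phi> x + \<phi> y) \<and> (\<forall>c x. \<phi> (c *\<^sub>C x) = c * \<phi> x)"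

text \<open>A substitute for a bounded continuous seminorm that only involves scalars: membership in \<open>U\<close> is
  tested by an equicontinuous family \<open>\<Phi>\<close> of complex linear functionals. It makes scalar function
  theory applicable to \<open>F\<close>-valued maps. The members of \<open>\<Phi>\<close> are the complexifications
  \<open>4 * u x - \<i> * 4 * u (\<i> *\<^sub>C x)\<close> of the real functionals \<open>u\<close> that are at most \<open>1\<close> on a convex
  neighbourhood \<open>V \<subseteq> U\<close>. A point outside \<open>V\<close> is separated from \<open>V\<close>, which makes some functional
  at least \<open>4\<close> there; the factor \<open>4\<close> leaves a gap between the bounds \<open>1\<close> and \<open>2\<close>.\<close>

theorem neighbourhood_polar:
  fixes U :: "'f::frechet_space set"
  assumes "open U" "0 \<in> U"
  obtains \<Phi> W where "\<And>\<phi>. \<phi> \<in> \<Phi> \<Longrightarrow> clinear_functional \<phi>"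
    "open W" "0 \<in> W" "\<And>\<phi> y. \<phi> \<in> \<Phi> \<Longrightarrow> y \<in> W \<Longrightarrow> norm (\<phi> y) \<le> 1"
    "\<And>y. (\<And>\<phi>. \<phi> \<in> \<Phi> \<Longrightarrow> norm (\<phi> y) \<le> 2) \<Longrightarrow> y \<in> U"
proof -
  obtain V where V: "open V" "0 \<in> V" "V \<subseteq> U"
     and Vc: "\<forall>x\<in>V. \<forall>y\<in>V. \<forall>u\<ge>0. \<forall>v\<ge>0. u + v = 1 \<longrightarrow> u *\<^sub>R x + v *\<^sub>R y \<in> V"
    using locally_convex[OF assms] by blast
  have conv: "convex V" unfolding convex_def using Vc by blast
  have absorb: "\<exists>t>0. t *\<^sub>R x \<in> V" for x :: 'f
  proof -
    have "eventually (\<lambda>c. c *\<^sub>C x \<in> V) (nhds 0)"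
      using tendsto_scaleC_zero V by (auto simp: tendsto_def)
    then obtain d where d: "d > 0" "\<And>c. dist c 0 < d \<Longrightarrow> c *\<^sub>C x \<in> V"
      by (auto simp: eventually_nhds_metric)
    have "(d/2) *\<^sub>R x \<in> V" unfolding scaleR_scaleC by (rule d(2)) (use d(1) in auto)
    then show ?thesis using d by (intro exI[of _ "d/2"]) auto
  qed
  define mk :: "('f \<Rightarrow> real) \<Rightarrow> 'f \<Rightarrow> complex" where
    "mk u x = Complex (4 * u x) (- 4 * u (\<i> *\<^sub>C x))" for u x
  define \<Phi> where "\<Phi> = mk ` {u. linear u \<and> (\<forall>x\<in>V. u x \<le> 1)}"
  \<comment> \<open>On \<open>W\<close>, both \<open>8 * u x\<close> and \<open>8 * u (\<i> *\<^sub>C x)\<close> are at most \<open>1\<close> in modulus, hence so is \<open>\<phi>\<close>.\<close>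
  define W where "W = (\<Inter>c\<in>{8, -8, 8 * \<i>, -8 * \<i>}. (\<lambda>x. c *\<^sub>C x) -` V)"
  show ?thesis
  proof
    fix \<phi> assume "\<phi> \<in> \<Phi>"
    then obtain u where u: "linear u" "\<And>x. x \<in> V \<Longrightarrow> u x \<le> 1" "\<phi> = mk u"
      by (auto simp: \<Phi>_def)
    have ua: "u (x + y) = u x + u y" for x y using u(1) by (simp add: linear_add)
    have uR: "u (complex_of_real r *\<^sub>C x) = r * u x" for r x
      using u(1) by (simp add: linear_scale flip: scaleR_scaleC)
    have uc: "u (c *\<^sub>C x) = Re c * u x + Im c * u (\<i> *\<^sub>C x)" for c x
    proof -
      have "c *\<^sub>C x = complex_of_real (Re c) *\<^sub>C x + complex_of_real (Im c) *\<^sub>C (\<i> *\<^sub>C x)"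
        by (simp add: scaleC_scaleC flip: scaleC_add_left) (metis complex_eq mult.commute)
      then show ?thesis by (simp add: ua uR)
    qed
    have ui: "u (\<i> *\<^sub>C c *\<^sub>C x) = - Im c * u x + Re c * u (\<i> *\<^sub>C x)" for c x
      using uc[of "\<i> * c" x] by (simp add: scaleC_scaleC)
    show "clinear_functional \<phi>"
      unfolding clinear_functional_def
    proof (intro conjI allI)
      show "\<phi> (x + y) = \<phi> x + \<phi> y" for x y
        by (simp add: u(3) mk_def complex_eq_iff ua scaleC_add_right)
      show "\<phi> (c *\<^sub>C x) = c * \<phi> x" for c x
        using uc[of c x] ui[of c x] by (simp add: u(3) mk_def complex_eq_iff algebra_simps)
    qed
    fix y assume y: "y \<in> W"
    have "c *\<^sub>C y \<in> V" if "c \<in> {8, -8, 8 * \<i>, -8 * \<i>}" for c using y that by (auto simp: W_def)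
    then have "u (c *\<^sub>C y) \<le> 1" if "c \<in> {8, -8, 8 * \<i>, -8 * \<i>}" for c using u(2) that by blast
    from this[of 8] this[of "-8"] this[of "8 * \<i>"] this[of "-8 * \<i>"]
    have "\<bar>8 * u y\<bar> \<le> 1" "\<bar>8 * u (\<i> *\<^sub>C y)\<bar> \<le> 1"
      using uc[of 8 y] uc[of "-8" y] uc[of "8 * \<i>" y] uc[of "- 8 * \<i>" y] by simp_all
    then have "\<bar>Re (\<phi> y)\<bar> \<le> 1/2" "\<bar>Im (\<phi> y)\<bar> \<le> 1/2" by (auto simp: u(3) mk_def)
    then show "norm (\<phi> y) \<le> 1" using cmod_le[of "\<phi> y"] by linarith
  next
    show "open W" unfolding W_def
      by (intro open_INT) (auto intro!: open_vimage[OF V(1)] continuous_scaleC)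
    show "0 \<in> W" using V by (auto simp: W_def scaleC_zero_right)
  next
    fix y assume y: "\<And>\<phi>. \<phi> \<in> \<Phi> \<Longrightarrow> norm (\<phi> y) \<le> 2"
    show "y \<in> U"
    proof (rule ccontr)
      assume "y \<notin> U"
      then have "y \<notin> V" using V by auto
      obtain u :: "'f \<Rightarrow> real" where u: "linear u" "\<And>x. x \<in> V \<Longrightarrow> u x \<le> 1" "u y \<ge> 1"
        by (rule separate_point_from_convex[OF conv absorb \<open>y \<notin> V\<close>]) blast
      then have "norm (mk u y) \<le> 2" by (intro y) (auto simp: \<Phi>_def)
      moreover have "Re (mk u y) \<ge> 4" using u by (simp add: mk_def)
      ultimately show False using complex_Re_le_cmod[of "mk u y"] by linarith
    qed
  qed
qed

lemma clinear_functional_diff: "clinear_functional \<phi> \<Longrightarrow> \<phi> (x - y) = \<phi> x - \<phi> y"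
  unfolding clinear_functional_def by (metis add_diff_cancel diff_add_cancel)

lemma continuous_clinear_functional:
  fixes W :: "'f::frechet_space set"
  assumes \<phi>: "clinear_functional \<phi>" and W: "open W" "0 \<in> W" "\<And>y. y \<in> W \<Longrightarrow> norm (\<phi> y) \<le> 1"
  shows "continuous_on UNIV \<phi>"
  unfolding continuous_on_def
proof (intro ballI tendstoI)
  fix x :: 'f and e :: real assume e: "e > 0"
  define c where "c = complex_of_real (2 / e)"
  have "((\<lambda>y. c *\<^sub>C (y - x)) \<longlongrightarrow> c *\<^sub>C (x - x)) (at x)"
    by (rule continuous_on_tendsto_compose[OF continuous_scaleC tendsto_diff[OF tendsto_ident_at tendsto_const]]) auto
  then have "eventually (\<lambda>y. c *\<^sub>C (y - x) \<in> W) (at x)"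
    using W by (auto simp: tendsto_def scaleC_zero_right)
  then show "eventually (\<lambda>y. dist (\<phi> y) (\<phi> x) < e) (at x within UNIV)"
  proof (rule eventually_mono)
    fix y assume "c *\<^sub>C (y - x) \<in> W"
    then have "norm (\<phi> (c *\<^sub>C (y - x))) \<le> 1" by (rule W)
    moreover have "\<phi> (c *\<^sub>C (y - x)) = c * \<phi> (y - x)" using \<phi> by (auto simp: clinear_functional_def)
    ultimately have "norm c * norm (\<phi> y - \<phi> x) \<le> 1"
      by (simp only: norm_mult clinear_functional_diff[OF \<phi>])
    moreover have "norm c = 2 / e" using e by (simp add: c_def norm_divide)
    ultimately have "2 / e * norm (\<phi> y - \<phi> x) \<le> 1" by simp
    then show "dist (\<phi> y) (\<phi> x) < e" using e by (simp add: dist_norm field_simps)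
  qed
qed

section \<open>Uniform Cauchy sequences in Frechet spaces\<close>

text \<open>This and the next lemma translate between entourages and neighbourhoods of \<open>0\<close>; they use the uniform
  continuity of subtraction and of addition at pairs with one coordinate on the diagonal.\<close>

lemma entourage_of_neighbourhood:
  fixes W :: "'f::frechet_space set"
  assumes "open W" "0 \<in> W"
  shows "\<exists>D. eventually D uniformity \<and> (\<forall>x y. D (x, y) \<longrightarrow> x - y \<in> W)"
proof -
  have "eventually (\<lambda>x. x \<in> W) (nhds 0)" using assms by (auto simp: eventually_nhds)
  then have "eventually (\<lambda>(x', y). x' = 0 \<longrightarrow> y \<in> W) uniformity" by (simp only: eventually_nhds_uniformity)
  then have "eventually (\<lambda>p. (\<lambda>(x', y). x' = 0 \<longrightarrow> y \<in> W) ((\<lambda>((a, b), (c, d)). (a - c, b - d)) p))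
      (uniformity \<times>\<^sub>F uniformity)"
    by (rule uniformly_continuous_minus'[unfolded filterlim_iff, rule_format])
  then obtain Q where Q: "eventually Q uniformity"
    "\<And>x y. Q x \<Longrightarrow> Q y \<Longrightarrow> (\<lambda>(x', y). x' = 0 \<longrightarrow> y \<in> W) ((\<lambda>((a, b), (c, d)). (a - c, b - d)) (x, y))"
    unfolding eventually_prod_same by blast
  have "x - y \<in> W" if "Q (y, x)" for x y
    using Q(2)[OF that uniformity_refl[OF Q(1), of y]] by simp
  moreover have "eventually (\<lambda>(x, y). Q (y, x)) uniformity" using uniformity_sym[OF Q(1)] .
  ultimately show ?thesis by (intro exI[of _ "\<lambda>(x, y). Q (y, x)"]) auto
qed

lemma neighbourhood_of_entourage:
  fixes E :: "'f::frechet_space \<times> 'f \<Rightarrow> bool"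
  assumes "eventually E uniformity"
  shows "\<exists>U. open U \<and> 0 \<in> U \<and> (\<forall>x y. x - y \<in> U \<longrightarrow> E (y, x))"
proof -
  have "eventually (\<lambda>p. E ((\<lambda>((a, b), (c, d)). (a + c, b + d)) p)) (uniformity \<times>\<^sub>F uniformity)"
    using assms by (rule uniformly_continuous_add'[unfolded filterlim_iff, rule_format])
  then obtain Q where Q: "eventually Q uniformity"
    "\<And>x y. Q x \<Longrightarrow> Q y \<Longrightarrow> E ((\<lambda>((a, b), (c, d)). (a + c, b + d)) (x, y))"
    unfolding eventually_prod_same by blast
  have "eventually (\<lambda>(x', y). x' = 0 \<longrightarrow> Q (0, y)) uniformity"
    using Q(1) by eventually_elim auto
  then have "eventually (\<lambda>y. Q (0, y)) (nhds (0::'f))" by (simp only: eventually_nhds_uniformity)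
  then obtain U where U: "open U" "0 \<in> U" "\<And>y. y \<in> U \<Longrightarrow> Q (0, y)" by (auto simp: eventually_nhds)
  have "E (y, x)" if "x - y \<in> U" for x y
    using Q(2)[OF uniformity_refl[OF Q(1), of y] U(3)[OF that]] by simp
  then show ?thesis using U by blast
qed

lemma uniformly_Cauchy_imp_convergent_uniformly_on_compacts:
  fixes f :: "nat \<Rightarrow> 'a::topological_space \<Rightarrow> 'f::complete_uniform_space"
  assumes C: "\<And>E. eventually E uniformity \<Longrightarrow> \<exists>N. \<forall>\<alpha>\<ge>N. \<forall>\<beta>\<ge>N. \<forall>z\<in>S. E (f \<alpha> z, f \<beta> z)"
  shows "convergent_uniformly_on_compacts f S"
proof -
  have "\<exists>l. (\<lambda>\<alpha>. f \<alpha> z) \<longlonglongrightarrow> l" if z: "z \<in> S" for z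
  proof -
    have "Cauchy (\<lambda>\<alpha>. f \<alpha> z)"
      unfolding Cauchy_uniform_iff using C z by meson
    then have "convergent_filter (filtermap (\<lambda>\<alpha>. f \<alpha> z) sequentially)"
      unfolding Cauchy_uniform by (rule cauchy_filter_convergent)
    then show ?thesis by (simp add: convergent_filter_iff filterlim_def)
  qed
  then obtain g where g: "\<And>z. z \<in> S \<Longrightarrow> (\<lambda>\<alpha>. f \<alpha> z) \<longlonglongrightarrow> g z" by metis
  have "\<forall>\<^sub>F k in sequentially. \<forall>z\<in>S. E (f k z, g z)" if E: "eventually E uniformity" for E
  proof -
    obtain D where D: "eventually D uniformity" "\<And>x y z. D (x, y) \<Longrightarrow> D (y, z) \<Longrightarrow> E (x, z)"
      using uniformity_transE[OF E] by blast
    obtain N where N: "\<And>\<alpha> \<beta> z. \<alpha> \<ge> N \<Longrightarrow> \<beta> \<ge> N \<Longrightarrow> z \<in> S \<Longrightarrow> D (f \<alpha> z, f \<beta> z)"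
      using C[OF D(1)] by blast
    have "E (f k z, g z)" if "k \<ge> N" "z \<in> S" for k z
    proof -
      have "eventually (\<lambda>(x', y). x' = g z \<longrightarrow> D (y, g z)) uniformity"
        using uniformity_sym[OF D(1)] by eventually_elim auto
      then have "eventually (\<lambda>y. D (y, g z)) (nhds (g z))" by (simp only: eventually_nhds_uniformity)
      then have "eventually (\<lambda>\<beta>. D (f \<beta> z, g z)) sequentially"
        using g[OF \<open>z \<in> S\<close>] unfolding filterlim_iff by blast
      then obtain M where "\<And>\<beta>. \<beta> \<ge> M \<Longrightarrow> D (f \<beta> z, g z)" unfolding eventually_sequentially by blast
      then have "D (f (max M N) z, g z)" by simp
      moreover have "D (f k z, f (max M N) z)" using that by (intro N) auto
      ultimately show ?thesis using D(2) by blast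
    qed
    then show ?thesis unfolding eventually_sequentially by blast
  qed
  then show ?thesis unfolding convergent_uniformly_on_compacts_def
    by (intro exI[of _ g]) (fast elim: eventually_mono)
qed

section \<open>Complex vectors\<close>

lemma continuous_on_smult:
  "continuous_on S f \<Longrightarrow> continuous_on S (g :: _ \<Rightarrow> complex ^ 'n)
   \<Longrightarrow> continuous_on S (\<lambda>x. f x *s g x)"
  unfolding vector_scalar_mult_def by (intro continuous_intros)

lemma norm_smult: "norm (c *s (v :: complex ^ 'n)) = norm c * norm v"
  by (simp add: norm_vec_def L2_set_def norm_mult power_mult_distrib real_sqrt_mult flip: sum_distrib_left)

lemma smult_of_real: "complex_of_real r *s (v :: complex ^ 'n) = r *\<^sub>R v"
  by (simp add: vec_eq_iff) (simp add: scaleR_conv_of_real)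

section \<open>Null sets in projective space\<close>

lemma Rep_cproj_of: "z \<noteq> 0 \<Longrightarrow> Rep_cproj (cproj_of z) = cline z"
  unfolding cproj_of_def by (rule Abs_cproj_inverse) auto

lemma cproj_of_surj: obtains z where "z \<noteq> 0" "l = cproj_of z"
proof -
  obtain z where "z \<noteq> 0" "Rep_cproj l = cline z" using Rep_cproj[of l] by auto
  then show ?thesis using that Rep_cproj_inverse[of l] by (metis cproj_of_def)
qed

lemma cline_scale: "c \<noteq> 0 \<Longrightarrow> cline (c *s z) = cline z"
proof -
  assume "c \<noteq> 0"
  then have "d *s z = (d / c) *s (c *s z)" for d by (simp add: vector_smult_assoc)
  then have "d *s z \<in> range (\<lambda>d. d *s (c *s z))" for d by blast
  then show ?thesis unfolding cline_def by (auto simp: vector_smult_assoc)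
qed

lemma cproj_of_scale: "c \<noteq> 0 \<Longrightarrow> cproj_of (c *s z) = cproj_of z"
  by (simp add: cproj_of_def cline_scale)

lemma cproj_of_eq_iff:
  assumes "z \<noteq> 0" "w \<noteq> 0"
  shows "cproj_of z = cproj_of w \<longleftrightarrow> (\<exists>c. c \<noteq> 0 \<and> w = c *s z)"
proof
  assume "cproj_of z = cproj_of w"
  then have "cline w = cline z" using Rep_cproj_of assms by metis
  moreover have "w \<in> cline w" unfolding cline_def by (rule range_eqI[of _ _ 1]) simp
  ultimately obtain c where "w = c *s z" by (auto simp: cline_def)
  with assms show "\<exists>c. c \<noteq> 0 \<and> w = c *s z" by (intro exI[of _ c]) auto
qed (auto simp: cproj_of_scale)

lemma open_scale: "open (S :: (complex ^ 'n) set) \<Longrightarrow> c \<noteq> 0 \<Longrightarrow> open ((*s) c -` S)"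
  by (rule open_vimage) (auto intro!: continuous_on_smult continuous_intros)

text \<open>The saturation of an open set is a union of its rescalings, so the quotient map is open. This
  gives projective space a countable basis, which is what makes the Borel sets of a product with
  projective space manageable.\<close>

lemma open_cproj_of_image:
  assumes "open S" "0 \<notin> S"
  shows "open (cproj_of ` S)"
proof -
  have "{z. z \<noteq> 0 \<and> cproj_of z \<in> cproj_of ` S} = (\<Union>c\<in>-{0}. (*s) c -` S)" (is "?L = ?R")
  proof (intro equalityI subsetI)
    fix z assume "z \<in> ?L"
    then obtain w where "w \<in> S" "cproj_of z = cproj_of w" "z \<noteq> 0" by auto
    then show "z \<in> ?R" using cproj_of_eq_iff[of z w] assms by auto
  next
    fix z assume "z \<in> ?R"
    then obtain c where c: "c \<noteq> 0" "c *s z \<in> S" by auto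
    then have "z \<noteq> 0" using assms by auto
    then show "z \<in> ?L" using c cproj_of_scale[of c z] by (metis (mono_tags, lifting) image_eqI mem_Collect_eq)
  qed
  then show ?thesis using assms by (simp add: open_cproj_def open_scale open_UN)
qed

instance cproj :: (finite) second_countable_topology
proof
  obtain B :: "(complex ^ 'a) set set" where B: "countable B" "topological_basis B"
    using ex_countable_basis by blast
  define C where "C = (\<lambda>b. cproj_of ` (b - {0})) ` B"
  have "topological_basis C"
  proof (rule topological_basisI)
    fix c assume "c \<in> C"
    then show "open c" using B topological_basis_open
      by (auto simp: C_def intro!: open_cproj_of_image open_Diff)
  next
    fix U :: "'a cproj set" and l assume U: "open U" "l \<in> U"
    obtain z where z: "z \<noteq> 0" "l = cproj_of z" using cproj_of_surj by blast
    have "open {z. z \<noteq> 0 \<and> cproj_of z \<in> U}" using U by (simp add: open_cproj_def)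
    then obtain b where "b \<in> B" "z \<in> b" "b \<subseteq> {z. z \<noteq> 0 \<and> cproj_of z \<in> U}"
      using topological_basisE[OF B(2)] z U by (metis (mono_tags, lifting) mem_Collect_eq)
    then show "\<exists>c\<in>C. l \<in> c \<and> c \<subseteq> U" using z by (auto simp: C_def intro!: bexI[of _ "cproj_of ` (b - {0})"])
  qed
  moreover have "countable C" using B by (simp add: C_def)
  ultimately show "\<exists>B::'a cproj set set. countable B \<and> open = generate_topology B"
    by (metis topological_basis_imp_subbasis)
qed

definition cinner :: "complex ^ 'n \<Rightarrow> complex ^ 'n \<Rightarrow> complex" where
  "cinner w a = (\<Sum>i\<in>UNIV. w $ i * cnj (a $ i))"

lemma cinner_self: "cinner a a = complex_of_real ((norm a)\<^sup>2)"
proof -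
  have "cinner a a = (\<Sum>i\<in>UNIV. complex_of_real ((norm (a $ i))\<^sup>2))"
    unfolding cinner_def by (intro sum.cong refl) (simp only: complex_norm_square)
  also have "\<dots> = complex_of_real ((norm a)\<^sup>2)"
    by (simp add: norm_vec_def L2_set_def sum_nonneg)
  finally show ?thesis .
qed

lemma cinner_diff_left: "cinner (x - y) a = cinner x a - cinner y a"
  and cinner_diff_right: "cinner a (x - y) = cinner a x - cinner a y"
  and cinner_scale_left: "cinner (c *s x) a = c * cinner x a"
  and cinner_scale_right: "cinner a (c *s x) = cnj c * cinner a x"
  and cinner_commute: "cinner y x = cnj (cinner x y)"
  by (simp_all add: cinner_def algebra_simps sum_subtractf sum_distrib_left)

text \<open>The Householder reflection in the hyperplane orthogonal to \<open>a\<close>. For \<open>a = 0\<close> the division by zero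
  makes it the identity, so it is unitary without exception.\<close>

definition householder :: "complex ^ 'n \<Rightarrow> complex ^ 'n ^ 'n" where
  "householder a = (\<chi> i j. (if i = j then 1 else 0) - 2 * a $ i * cnj (a $ j) / cinner a a)"

lemma householder_mult: "householder a *v w = w - (2 * cinner w a / cinner a a) *s a"
proof -
  have "(\<Sum>j\<in>UNIV. ((if i = j then 1 else 0) - 2 * a $ i * cnj (a $ j) / cinner a a) * w $ j)
     = w $ i - (2 * cinner w a / cinner a a) * a $ i" for i
  proof -
    have "(\<Sum>j\<in>UNIV. ((if i = j then 1 else 0) - 2 * a $ i * cnj (a $ j) / cinner a a) * w $ j)
      = (\<Sum>j\<in>UNIV. (if i = j then w $ j else 0) - (2 * a $ i / cinner a a) * (w $ j * cnj (a $ j)))"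
      by (intro sum.cong) (auto simp: algebra_simps)
    also have "\<dots> = w $ i - (2 * a $ i / cinner a a) * cinner w a"
      unfolding sum_subtractf cinner_def[of w] sum_distrib_left[symmetric] by simp
    finally show ?thesis by simp
  qed
  then show ?thesis by (simp add: vec_eq_iff matrix_vector_mult_def householder_def)
qed

lemma householder_involution: "householder a *v (householder a *v w) = w"
proof (cases "a = 0")
  case False
  then have "cinner a a \<noteq> 0" by (simp add: cinner_self)
  then show ?thesis 
    by (simp add: householder_mult cinner_diff_left cinner_scale_left diff_divide_distrib right_diff_distrib
        vector_ssub_ldistrib vector_sub_rdistrib)
qed (simp add: householder_mult)

lemma householder_unitary: "unitary_matrix (householder a)"
proof -
  have "map_matrix cnj (transpose (householder a)) = householder a"
    by (simp add: vec_eq_iff map_matrix_def transpose_def householder_def cinner_self)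
  then show ?thesis unfolding unitary_matrix_def
    by (simp add: matrix_eq householder_involution flip: matrix_vector_mul_assoc)
qed

lemma householder_nonzero: "w \<noteq> 0 \<Longrightarrow> householder a *v w \<noteq> 0"
  using householder_involution[of a w] by (metis matrix_vector_mult_0_right)

lemma cproj_act_householder: "w \<noteq> 0 \<Longrightarrow> cproj_act (householder a) (cproj_of w) = cproj_of (householder a *v w)"
proof -
  assume w: "w \<noteq> 0"
  have "(*v) (householder a) ` cline w = cline (householder a *v w)"
    by (simp add: cline_def image_image vec.scale)
  then show ?thesis using w by (simp add: cproj_act_def Rep_cproj_of) (simp add: cproj_of_def)
qed

lemma householder_scale: "c \<noteq> 0 \<Longrightarrow> householder (c *s a) = householder a"
  by (auto simp: householder_def vec_eq_iff cinner_scale_left cinner_scale_right)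

lemma continuous_on_cinner: "continuous_on S f \<Longrightarrow> continuous_on S g \<Longrightarrow> continuous_on S (\<lambda>x. cinner (f x) (g x))"
  unfolding cinner_def by (intro continuous_intros)

text \<open>Away from \<open>a = 0\<close> the map is continuous because the quotient map is open; on the closed slice
  \<open>a = 0\<close> it is the identity.\<close>

lemma householder_joint_measurable:
  "(\<lambda>(l, a). cproj_act (householder a) l) \<in> borel \<Otimes>\<^sub>M borel \<rightarrow>\<^sub>M (borel :: 'n::finite cproj measure)"
proof -
  let ?F = "\<lambda>(l, a). cproj_act (householder a) l :: 'n cproj"
  have op: "open {x \<in> UNIV \<times> (- {0}). ?F x \<in> N}" if N: "open N" for N
  proof (rule Topological_Spaces.openI)
    fix x assume x: "x \<in> {x \<in> UNIV \<times> (- {0}). ?F x \<in> N}"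
    obtain l a where la: "x = (l, a)" "a \<noteq> 0" "cproj_act (householder a) l \<in> N" using x by auto
    obtain w where w: "w \<noteq> 0" "l = cproj_of w" using cproj_of_surj by blast
    define M where "M = {z. z \<noteq> 0 \<and> cproj_of z \<in> N}"
    have M: "open M" using N by (simp add: M_def open_cproj_def)
    define P where "P = {p. fst p \<noteq> (0::complex^'n) \<and> snd p \<noteq> 0 \<and> householder (snd p) *v fst p \<in> M}"
    have "P = (- {0}) \<times> (- {0}) \<inter> (\<lambda>p. householder (snd p) *v fst p) -` M" by (auto simp: P_def)
    moreover have "open \<dots>"
      unfolding householder_mult
      by (intro continuous_open_preimage M open_Times open_Compl closed_singleton)
         (auto intro!: continuous_intros continuous_on_smult continuous_on_cinner simp: cinner_self)
    ultimately have "open P" by simp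
    moreover have "(w, a) \<in> P" using la w householder_nonzero[of w a] by (auto simp: P_def M_def cproj_act_householder)
    ultimately obtain A B where AB: "open A" "open B" "(w, a) \<in> A \<times> B" "A \<times> B \<subseteq> P"
      by (rule open_prod_elim)
    have nz: "0 \<notin> A" "0 \<notin> B" using AB by (auto simp: P_def)
    have "(cproj_of ` A) \<times> B \<subseteq> {x \<in> UNIV \<times> (- {0}). ?F x \<in> N}"
    proof clarsimp
      fix b z assume "b \<in> B" "z \<in> A"
      then have "(z, b) \<in> P" using AB by auto
      then show "b \<noteq> 0 \<and> cproj_act (householder b) (cproj_of z) \<in> N"
        by (auto simp: P_def M_def cproj_act_householder)
    qed
    moreover have "open ((cproj_of ` A) \<times> B)" using AB nz by (intro open_Times open_cproj_of_image)
    ultimately show "\<exists>T. open T \<and> x \<in> T \<and> T \<subseteq> {x \<in> UNIV \<times> (- {0}). ?F x \<in> N}"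
      using la w AB by (intro exI[of _ "(cproj_of ` A) \<times> B"]) auto
  qed
  have id: "cproj_act (householder 0) l = l" for l :: "'n cproj"
  proof -
    obtain w where w: "w \<noteq> 0" "l = cproj_of w" using cproj_of_surj by blast
    then show ?thesis by (simp add: cproj_act_householder) (simp add: householder_mult)
  qed
  have "?F \<in> borel_measurable (borel :: ('n cproj \<times> (complex ^ 'n)) measure)"
  proof (rule borel_measurableI)
    fix N :: "'n cproj set" assume N: "open N"
    have "?F -` N \<inter> space borel = {x \<in> UNIV \<times> (- {0}). ?F x \<in> N} \<union> N \<times> {0}"
      by (auto simp: id)
    moreover have "N \<times> {0} \<in> sets (borel \<Otimes>\<^sub>M (borel :: (complex ^ 'n) measure))" using N by (intro pair_measureI) auto
    then have "N \<times> {0} \<in> sets (borel :: ('n cproj \<times> (complex ^ 'n)) measure)" by (simp only: borel_prod)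
    ultimately show "?F -` N \<inter> space borel \<in> sets (borel :: ('n cproj \<times> (complex ^ 'n)) measure)"
      using op[OF N] by (auto intro!: sets.Un)
  qed
  then show ?thesis by (simp add: borel_prod)
qed

lemma differentiable_smult:
  fixes f :: "complex ^ 'm \<Rightarrow> complex" and g :: "complex ^ 'm \<Rightarrow> complex ^ 'n"
  assumes "f differentiable_on S" "g differentiable_on S"
  shows "(\<lambda>x. f x *s g x) differentiable_on S"
proof -
  have "bounded_bilinear (\<lambda>(c::complex) (v :: complex ^ 'n). c *s v)"
  proof (rule bounded_bilinear.intro)
    have "norm (c *s v) \<le> norm c * norm v * 1" for c :: complex and v :: "complex ^ 'n"
      by (simp add: norm_smult)
    then show "\<exists>K. \<forall>c (v :: complex ^ 'n). norm (c *s v) \<le> norm (c::complex) * norm v * K" by blast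
  qed (auto simp: vec_eq_iff algebra_simps)
  from bounded_bilinear.FDERIV[OF this] show ?thesis
    using assms unfolding differentiable_on_def differentiable_def by blast
qed

lemma differentiable_nth: "(\<lambda>x :: complex ^ 'n. x $ i) differentiable F"
  by (intro bounded_linear_imp_differentiable bounded_linear_vec_nth)

lemma differentiable_cnj_nth: "(\<lambda>x :: complex ^ 'n. cnj (x $ i)) differentiable F"
  by (intro bounded_linear_imp_differentiable bounded_linear_compose[OF bounded_linear_cnj] bounded_linear_vec_nth)

lemma differentiable_cinner_const: "(\<lambda>x. cinner x w) differentiable_on S"
  "(\<lambda>x. cinner w x) differentiable_on S" 
  unfolding cinner_def differentiable_on_def
  by (intro ballI differentiable_sum finite differentiable_mult differentiable_const
      differentiable_nth differentiable_cnj_nth)+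

text \<open>Every line contains a vector of the form \<open>householder a *v w\<close>: for a unit vector \<open>v\<close> whose phase is
  chosen such that \<open>cinner w v\<close> is real and nonpositive, \<open>a = w - v\<close> does it, and then
  \<open>cinner a w \<noteq> 0\<close>. The map \<open>F\<close> below is \<open>householder a *v w\<close> times the scalar \<open>cinner a w * cinner a a\<close>; it is
  a polynomial in real coordinates with \<open>F (t *s a) = (t * (t * cnj t)) *s F a\<close>. The set of parameters
  \<open>a\<close> is invariant under complex scaling, so its image under \<open>F\<close> covers the whole cone over \<open>N\<close>.
  Differentiable maps between spaces of equal dimension preserve null sets.\<close>

lemma null_cone_of_null_householder:
  fixes N :: "'n::finite cproj set" and w :: "complex ^ 'n"
  assumes w: "norm w = 1" and T: "negligible {a. cproj_of (householder a *v w) \<in> N}"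
  shows "negligible {z. z \<noteq> 0 \<and> cproj_of z \<in> N}"
proof -
  define T where "T = {a. cproj_of (householder a *v w) \<in> N}"
  define F where "F a = cinner a w *s (cinner a a *s w - (2 * cinner w a) *s a)" for a
  have "F differentiable_on T"
  proof -
    have "(\<lambda>a :: complex ^ 'n. cinner a a) differentiable_on T"
      unfolding cinner_def differentiable_on_def
      by (intro ballI differentiable_sum finite differentiable_mult differentiable_nth differentiable_cnj_nth)
    then show ?thesis unfolding F_def
      by (intro differentiable_smult differentiable_on_diff differentiable_cinner_const differentiable_on_mult
         differentiable_on_const differentiable_on_ident)
  qed
  then have "negligible (F ` T)"
    using T by (intro negligible_differentiable_image_negligible) (auto simp: T_def)
  moreover have "{z. z \<noteq> 0 \<and> cproj_of z \<in> N} \<subseteq> F ` T"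
  proof clarsimp
    fix z :: "complex ^ 'n" assume z: "z \<noteq> 0" "cproj_of z \<in> N"
    \<comment> \<open>The phase that makes the inner product real and nonpositive.\<close>
    obtain c where c: "norm c = 1" "c * cinner w z = - complex_of_real (norm (cinner w z))"
    proof (cases "cinner w z = 0")
      case False
      then show ?thesis
        by (intro that[of "- cnj (cinner w z) / norm (cinner w z)"])
          (simp_all add: norm_divide complex_norm_square[symmetric] mult.commute[of "cnj _"] power2_eq_square)
    qed (use that[of 1] in auto)
    define d where "d = cnj c / complex_of_real (norm z)"
    have d0: "d \<noteq> 0" using c z by (auto simp: d_def)
    have cc: "c * cnj c = 1" using c by (simp flip: complex_norm_square)
    define v where "v = d *s z"
    define \<rho> where "\<rho> = norm (cinner w z) / norm z"
    have \<rho>: "\<rho> \<ge> 0" by (simp add: \<rho>_def)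
    have wv: "cinner w v = - complex_of_real \<rho>"
      using c by (simp add: v_def d_def cinner_scale_right \<rho>_def)
    have vw: "cinner v w = - complex_of_real \<rho>" using cinner_commute[of v w] wv by simp
    have "cinner v v = d * cnj d * cinner z z" by (simp add: v_def cinner_scale_right cinner_scale_left)
    also have "\<dots> = 1" using z cc unfolding cinner_self by (simp add: d_def power2_eq_square field_simps)
    finally have vv: "cinner v v = 1" .
    have ww: "cinner w w = 1" using w by (simp add: cinner_self)
    define a where "a = w - v"
    have wa: "cinner w a = 1 + complex_of_real \<rho>" "cinner a w = 1 + complex_of_real \<rho>"
      and aa: "cinner a a = 2 * (1 + complex_of_real \<rho>)"
      by (simp_all add: a_def cinner_diff_left cinner_diff_right wv vw ww vv)
    have nz: "1 + complex_of_real \<rho> \<noteq> 0" using \<rho> by (metis add_nonneg_eq_0_iff of_real_1 of_real_add of_real_eq_0_iff zero_le_one zero_neq_one)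
    have Fa: "F a = (2 * (1 + complex_of_real \<rho>)^2) *s v"
    proof -
      have "F a = (1 + complex_of_real \<rho>) *s
          ((2 * (1 + complex_of_real \<rho>)) *s w - (2 * (1 + complex_of_real \<rho>)) *s a)"
        unfolding F_def wa aa ..
      also have "\<dots> = (2 * (1 + complex_of_real \<rho>)^2) *s v"
        by (simp add: a_def vec_eq_iff power2_eq_square algebra_simps)
      finally show ?thesis .
    qed
    have "householder a *v w = v"
    proof -
      have "2 * (1 + complex_of_real \<rho>) \<noteq> 0" using nz by (simp only: mult_eq_0_iff) simp
      then have "2 * cinner w a / cinner a a = 1" unfolding wa aa by (rule divide_self)
      then show ?thesis by (simp only: householder_mult) (simp add: a_def)
    qed
    define R where "R = 2 * (1 + \<rho>)^2"
    have R: "R > 0" using \<rho> by (simp add: R_def)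
    \<comment> \<open>\<open>F\<close> is homogeneous of degree \<open>3\<close>, so a cube root adjusts the length.\<close>
    define \<tau> where "\<tau> = root 3 (norm z / R)"
    have \<tau>: "\<tau> > 0" "\<tau> ^ 3 = norm z / R" using R z by (auto simp: \<tau>_def)
    define t where "t = complex_of_real \<tau> * c"
    have t: "t \<noteq> 0" "t * cnj t = complex_of_real (\<tau>^2)" using \<tau> c cc 
      by (auto simp: t_def power2_eq_square algebra_simps)
    have "householder (t *s a) *v w = v"
      using \<open>householder a *v w = v\<close> by (simp add: householder_scale[OF t(1)])
    moreover have "cproj_of v = cproj_of z" using d0 by (simp add: v_def cproj_of_scale)
    ultimately have "t *s a \<in> T" using z by (simp add: T_def)
    moreover have "F (t *s a) = z"
    proof -
      have "F (t *s a) = (t * (t * cnj t)) *s F a"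
        by (simp add: F_def cinner_scale_left cinner_scale_right vec_eq_iff algebra_simps)
      also have "\<dots> = (t * (t * cnj t) * complex_of_real R * d) *s z"
        by (simp add: Fa R_def v_def vector_smult_assoc algebra_simps)
      also have "t * (t * cnj t) * complex_of_real R * d = complex_of_real (\<tau>^3 * R / norm z) * (c * cnj c)"
        unfolding t(2) by (simp add: t_def d_def power2_eq_square power3_eq_cube algebra_simps)
      also have "\<dots> = 1" using \<tau> R z by (simp add: cc)
      finally show ?thesis by simp
    qed
    ultimately show "z \<in> F ` T" by force
  qed
  ultimately show ?thesis by (rule negligible_subset)
qed

text \<open>By invariance, for each \<open>a\<close> almost no line is reflected into \<open>N\<close>. By Fubini's theorem some line
  \<open>l\<close> is reflected into \<open>N\<close> for almost no \<open>a\<close>, and the previous lemma applies to \<open>l\<close>. Thus the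
  reflections alone compare an invariant measure with Lebesgue measure.\<close>

theorem null_cone_of_invariant_null:
  fixes N :: "'n::finite cproj set"
  assumes \<nu>: "cproj_invariant_measure \<nu>" and N: "N \<in> null_sets \<nu>"
  shows "negligible {z. z \<noteq> 0 \<and> cproj_of z \<in> N}"
proof -
  interpret prob_space \<nu> using \<nu> by (simp add: cproj_invariant_measure_def)
  have sets: "sets \<nu> = sets borel" using \<nu> by (simp add: cproj_invariant_measure_def)
  interpret pair_sigma_finite \<nu> "lborel :: (complex ^ 'n) measure" ..
  have Nb: "N \<in> sets borel" using N sets by auto
  have meas: "(\<lambda>(l, a). cproj_act (householder a) l) \<in> \<nu> \<Otimes>\<^sub>M lborel \<rightarrow>\<^sub>M (borel :: 'n cproj measure)"
    using householder_joint_measurable by (subst measurable_cong_sets[OF sets_pair_measure_cong[OF sets sets_lborel] refl])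
  have "AE l in \<nu>. cproj_act (householder a) l \<notin> N" for a
  proof -
    have m: "cproj_act (householder a) \<in> \<nu> \<rightarrow>\<^sub>M borel"
      using measurable_Pair1[OF meas, of a] by simp
    have "emeasure (distr \<nu> borel (cproj_act (householder a))) N = emeasure \<nu> N"
      using \<nu> householder_unitary[of a] by (simp add: cproj_invariant_measure_def)
    then have "emeasure \<nu> (cproj_act (householder a) -` N \<inter> space \<nu>) = 0"
      using N by (simp add: emeasure_distr[OF m Nb] null_setsD1)
    then show ?thesis
      by (intro AE_I[of _ _ "cproj_act (householder a) -` N \<inter> space \<nu>"]) (use m Nb in \<open>auto intro: measurable_sets\<close>)
  qed
  then have "AE a in lborel. AE l in \<nu>. cproj_act (householder a) l \<notin> N" by simp
  moreover have "{x \<in> space (\<nu> \<Otimes>\<^sub>M lborel). (case x of (l, a) \<Rightarrow> cproj_act (householder a) l \<notin> N)} \<in> sets (\<nu> \<Otimes>\<^sub>M lborel)"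
  proof -
    have "{x \<in> space (\<nu> \<Otimes>\<^sub>M lborel). (case x of (l, a) \<Rightarrow> cproj_act (householder a) l \<notin> N)}
      = (\<lambda>(l, a). cproj_act (householder a) l) -` (- N) \<inter> space (\<nu> \<Otimes>\<^sub>M lborel)" by auto
    then show ?thesis using measurable_sets[OF meas, of "- N"] Nb by auto
  qed
  ultimately have "AE l in \<nu>. AE a in lborel. cproj_act (householder a) l \<notin> N"
    using AE_commute[of "\<lambda>l a. cproj_act (householder a) l \<notin> N"] by (simp add: case_prod_beta')
  then obtain l where l: "AE a in lborel. cproj_act (householder a) l \<notin> N"
    using AE_False by (metis (mono_tags, lifting) AE_mp AE_I2)
  obtain w' where w': "w' \<noteq> 0" "l = cproj_of w'" using cproj_of_surj by blast
  define w where "w = complex_of_real (1 / norm w') *s w'"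
  have lw: "l = cproj_of w" using w' by (simp add: w_def cproj_of_scale)
  have nw: "norm w = 1"
  proof -
    have "complex_of_real ((norm w)\<^sup>2) = 1"
      unfolding cinner_self[symmetric] using w'
      by (simp add: w_def cinner_scale_left cinner_scale_right) (simp add: cinner_self power2_eq_square)
    then have "(norm w)\<^sup>2 = 1" by (metis of_real_eq_1_iff)
    then show ?thesis by (simp add: power2_eq_1_iff) (metis norm_ge_zero not_one_le_zero neg_0_le_iff_le)
  qed
  then have "w \<noteq> 0" by auto
  then have eq: "cproj_act (householder a) l = cproj_of (householder a *v w)" for a
    by (simp add: lw cproj_act_householder)
  obtain M where M: "M \<in> null_sets lborel" "{a. cproj_of (householder a *v w) \<in> N} \<subseteq> M"
    using l unfolding eventually_ae_filter by (auto simp: eq)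
  then have "negligible M" by (simp add: negligible_iff_null_sets null_sets_completionI)
  then show ?thesis
    using M by (intro null_cone_of_null_householder[OF nw]) (rule negligible_subset)
qed

section \<open>A Remez inequality in one variable\<close>

lemma nn_integral_inverse_sqrt_right:
  "(\<integral>\<^sup>+s. ennreal (inverse (sqrt s)) * indicator {0<..1} s \<partial>lborel) = 2"
proof -
  have "((\<lambda>x. x powr (-1/2)) has_integral (1 powr (-1/2+1) / (-1/2+1))) {0..(1::real)}"
    by (intro has_integral_powr_from_0) auto
  then have I: "((\<lambda>x::real. x powr (-1/2)) has_integral 2) {0..1}" by simp
  have "(\<integral>\<^sup>+x. ennreal (x powr (-1/2)) * indicator {0..1} x \<partial>lborel) = ennreal 2"
    by (rule nn_integral_has_integral_lebesgue'[OF _ I]) auto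
  moreover have "(\<integral>\<^sup>+x. ennreal (x powr (-1/2)) * indicator {0..1} x \<partial>lborel)
     = (\<integral>\<^sup>+s. ennreal (inverse (sqrt s)) * indicator {0<..1} s \<partial>lborel)"
    by (intro nn_integral_cong) (auto split: split_indicator simp: powr_minus powr_half_sqrt)
  ultimately show ?thesis by simp
qed

text \<open>The singularity at \<open>x\<close> is covered by the two one-sided ones, each of integral \<open>2\<close>, and at distance
  more than \<open>1\<close> the integrand is at most \<open>1\<close>.\<close>

lemma nn_integral_inverse_sqrt_dist:
  "(\<integral>\<^sup>+s. ennreal (inverse (sqrt \<bar>s - x\<bar>)) * indicator {0..1} s \<partial>lborel) \<le> 5"
proof -
  let ?g = "\<lambda>s::real. ennreal (inverse (sqrt s)) * indicator {0<..1} s"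
  have g[measurable]: "?g \<in> borel_measurable borel" by measurable
  have "(\<integral>\<^sup>+s. ennreal (inverse (sqrt \<bar>s - x\<bar>)) * indicator {0..1} s \<partial>lborel)
     \<le> (\<integral>\<^sup>+s. (?g (- x + 1 * s) + ?g (x + (-1) * s)) + indicator {0..1} s \<partial>lborel)"
  proof (rule nn_integral_mono)
    fix s :: real
    have *: "inverse (sqrt y) \<le> 1" if "y > 1" for y :: real
      using that by (simp add: inverse_le_1_iff)
    show "ennreal (inverse (sqrt \<bar>s - x\<bar>)) * indicator {0..1} s
       \<le> (?g (- x + 1 * s) + ?g (x + (-1) * s)) + indicator {0..1} s"
    proof (cases "s \<in> {0..1}")
      case True
      consider "s = x" | "0 < s - x" "s - x \<le> 1" | "0 < x - s" "x - s \<le> 1" | "\<bar>s - x\<bar> > 1" by linarith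
      then show ?thesis
      proof cases
        case 2 then have "\<bar>s - x\<bar> = - x + 1 * s" by simp
        with 2 True show ?thesis by (simp add: add_increasing2 add.assoc)
      next
        case 3 then have "\<bar>s - x\<bar> = x + (-1) * s" by simp
        with 3 True show ?thesis by (simp add: add_increasing2 add_increasing add.assoc)
      next
        case 4 
        then have "ennreal (inverse (sqrt \<bar>s - x\<bar>)) \<le> 1" using *[of "\<bar>s - x\<bar>"] by (simp add: ennreal_le_1)
        then show ?thesis using True by (simp add: add_increasing)
      qed auto
    qed auto
  qed
  also have "\<dots> = (\<integral>\<^sup>+s. ?g (- x + 1 * s) \<partial>lborel) + (\<integral>\<^sup>+s. ?g (x + (-1) * s) \<partial>lborel)
      + (\<integral>\<^sup>+s. indicator {0..1::real} s \<partial>lborel)"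
    by (simp add: nn_integral_add)
  also have "(\<integral>\<^sup>+s. ?g (- x + 1 * s) \<partial>lborel) = 2"
    using nn_integral_real_affine[OF g, of 1 "-x"] nn_integral_inverse_sqrt_right by simp
  also have "(\<integral>\<^sup>+s. ?g (x + (-1) * s) \<partial>lborel) = 2"
    using nn_integral_real_affine[OF g, of "-1" x] nn_integral_inverse_sqrt_right by simp
  also have "(\<integral>\<^sup>+s. indicator {0..1::real} s \<partial>lborel) = 1" by simp
  finally show ?thesis by simp
qed

text \<open>For a polynomial \<open>q\<close> with roots \<open>a\<close>, the ratio of \<open>q 0\<close> to \<open>q s\<close> is, in modulus, the product of
  the squares of these weights. The square root makes the weight integrable in \<open>s\<close>.\<close>

definition root_weight :: "complex \<Rightarrow> real \<Rightarrow> real" where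
  "root_weight a s = sqrt (norm a / norm (complex_of_real s - a))"

lemma root_weight_measurable[measurable]: "root_weight a \<in> borel_measurable borel"
  unfolding root_weight_def by measurable

lemma root_weight_nonneg: "root_weight a s \<ge> 0" by (simp add: root_weight_def)

text \<open>Since \<open>norm a \<le> 1 + norm (s - a)\<close> on the unit interval, the weight is almost
  everywhere at most \<open>1 + inverse (sqrt \<bar>s - Re a\<bar>)\<close>; in particular the bound does not depend on the root.\<close>

lemma nn_integral_root_weight:
  "(\<integral>\<^sup>+s. ennreal (root_weight a s) * indicator {0..1} s \<partial>lborel) \<le> 6"
proof -
  have "(\<integral>\<^sup>+s. ennreal (root_weight a s) * indicator {0..1} s \<partial>lborel)
    \<le> (\<integral>\<^sup>+s. indicator {0..1} s + ennreal (inverse (sqrt \<bar>s - Re a\<bar>)) * indicator {0..1} s \<partial>lborel)"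
  proof (rule nn_integral_mono_AE)
    have "AE s in lborel. s \<noteq> Re a" by (rule AE_lborel_singleton)
    then show "AE s in lborel. ennreal (root_weight a s) * indicator {0..1} s
       \<le> indicator {0..1} s + ennreal (inverse (sqrt \<bar>s - Re a\<bar>)) * indicator {0..1} s"
    proof eventually_elim
      fix s :: real assume s: "s \<noteq> Re a"
      show "ennreal (root_weight a s) * indicator {0..1} s
       \<le> indicator {0..1} s + ennreal (inverse (sqrt \<bar>s - Re a\<bar>)) * indicator {0..1} s"
      proof (cases "s \<in> {0..1}")
        case True
        define d where "d = norm (complex_of_real s - a)"
        have d: "\<bar>s - Re a\<bar> \<le> d" using abs_Re_le_cmod[of "complex_of_real s - a"] by (simp add: d_def)
        have d0: "d > 0" using d s by linarith
        have "norm a \<le> norm (complex_of_real s) + d"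
          unfolding d_def by (metis norm_triangle_sub norm_minus_commute)
        then have "norm a / d \<le> 1 + 1 / d" using True d0 by (simp add: field_simps)
        then have "root_weight a s \<le> sqrt (1 + 1 / d)" by (simp add: root_weight_def d_def)
        also have "\<dots> \<le> sqrt 1 + sqrt (1 / d)" using d0 by (intro sqrt_add_le_add_sqrt) auto
        also have "sqrt (1 / d) \<le> inverse (sqrt \<bar>s - Re a\<bar>)"
          using d s by (simp add: real_sqrt_divide field_simps)
        finally have "ennreal (root_weight a s) \<le> ennreal (1 + inverse (sqrt \<bar>s - Re a\<bar>))"
          by (intro ennreal_leI) simp
        also have "\<dots> = 1 + ennreal (inverse (sqrt \<bar>s - Re a\<bar>))" by (subst ennreal_plus) auto
        finally show ?thesis using True by simp
      qed auto
    qed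
  qed
  also have "\<dots> = 1 + (\<integral>\<^sup>+s. ennreal (inverse (sqrt \<bar>s - Re a\<bar>)) * indicator {0..1} s \<partial>lborel)"
    by (subst nn_integral_add) auto
  also have "\<dots> \<le> 1 + 5" by (intro add_left_mono nn_integral_inverse_sqrt_dist)
  finally show ?thesis by simp
qed

lemma sum_mset_nonneg:
  fixes w :: "'a \<Rightarrow> real"
  shows "(\<And>a. w a \<ge> 0) \<Longrightarrow> (\<Sum>a\<in>#M. w a) \<ge> 0"
  by (induction M) auto

lemma prod_mset_nonneg:
  fixes w :: "'a \<Rightarrow> real"
  shows "(\<And>a. w a \<ge> 0) \<Longrightarrow> (\<Prod>a\<in>#M. w a) \<ge> 0"
  by (induction M) auto

text \<open>The inequality of arithmetic and geometric means, in the form that follows from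
  \<open>w \<le> c * exp (w / c - 1)\<close>.\<close>

lemma prod_le_power_of_sum_le:
  fixes w :: "'a \<Rightarrow> real"
  assumes "\<And>a. w a \<ge> 0" "(c::real) > 0" "(\<Sum>a\<in>#M. w a) \<le> c * size M"
  shows "(\<Prod>a\<in>#M. w a) \<le> c ^ size M"
proof -
  have "(\<Prod>a\<in>#M. w a) \<le> c ^ size M * exp ((\<Sum>a\<in>#M. w a) / c - size M)"
  proof (induction M)
    case (add x M)
    have "w x / c \<le> exp (w x / c - 1)" using exp_ge_add_one_self[of "w x / c - 1"] by simp
    then have "w x \<le> c * exp (w x / c - 1)" using assms(2) by (simp add: field_simps)
    then have "w x * (\<Prod>a\<in>#M. w a) \<le> (c * exp (w x / c - 1)) * (c ^ size M * exp ((\<Sum>a\<in>#M. w a) / c - size M))"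
      using assms(1) by (intro mult_mono add prod_mset_nonneg) (auto simp: assms(2) less_imp_le)
    also have "\<dots> = c ^ size (add_mset x M) * exp ((\<Sum>a\<in>#add_mset x M. w a) / c - size (add_mset x M))"
      by (simp add: mult_exp_exp add_divide_distrib algebra_simps)
    finally show ?case by simp
  qed auto
  also have "\<dots> \<le> c ^ size M * 1"
    using assms by (intro mult_left_mono) (auto simp: field_simps)
  finally show ?thesis by simp
qed

lemma nn_integral_sum_root_weight:
  "(\<integral>\<^sup>+s. ennreal (\<Sum>a\<in>#M. root_weight a s) * indicator {0..1} s \<partial>lborel) \<le> 6 * size M"
proof (induction M)
  case (add a M)
  have [measurable]: "(\<lambda>s. \<Sum>a\<in>#M. root_weight a s) \<in> borel_measurable borel"
    by (induction M) auto
  have "(\<integral>\<^sup>+s. ennreal (\<Sum>a\<in>#add_mset a M. root_weight a s) * indicator {0..1} s \<partial>lborel)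
    = (\<integral>\<^sup>+s. ennreal (root_weight a s) * indicator {0..1} s
        + ennreal (\<Sum>a\<in>#M. root_weight a s) * indicator {0..1} s \<partial>lborel)"
    by (intro nn_integral_cong)
       (simp add: ennreal_plus root_weight_nonneg sum_mset_nonneg distrib_right)
  also have "\<dots> = (\<integral>\<^sup>+s. ennreal (root_weight a s) * indicator {0..1} s \<partial>lborel)
        + (\<integral>\<^sup>+s. ennreal (\<Sum>a\<in>#M. root_weight a s) * indicator {0..1} s \<partial>lborel)"
    by (intro nn_integral_add) measurable
  also have "\<dots> \<le> 6 + of_nat (6 * size M)" by (intro add_mono add nn_integral_root_weight)
  finally show ?case by (simp add: distrib_left)
qed simp

text \<open>On average over the unit interval the root weights sum up to at most \<open>6\<close> times the number of roots,
  so on a set of measure at least \<open>1/4\<close> some point has sum at most \<open>25\<close> times that number. There the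
  product of the weights is at most \<open>25 ^ degree q\<close>, and \<open>625\<close> is the square of \<open>25\<close>.\<close>

theorem Remez_at_zero:
  fixes q :: "complex poly"
  assumes deg: "degree q \<le> k" and A: "A \<in> sets borel" "A \<subseteq> {0..1}" "emeasure lborel A \<ge> ennreal (1/4)"
    and bound: "\<And>s. s \<in> A \<Longrightarrow> norm (poly q (complex_of_real s)) \<le> m"
  shows "norm (poly q 0) \<le> 625 ^ k * m"
proof (cases "q = 0")
  case True
  have "A \<noteq> {}" using A by auto
  then have "m \<ge> 0" using bound True by auto
  then show ?thesis using True by simp
next
  case False
  obtain M where M: "size M = degree q" "q = smult (lead_coeff q) (\<Prod>x\<in>#M. [:-x, 1:])"
    using alg_closed_imp_factorization[OF False] by blast
  define c where "c = lead_coeff q"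
  have q: "poly q z = c * (\<Prod>x\<in>#M. z - x)" for z
  proof -
    have "poly (\<Prod>x\<in>#M. [:-x, 1:]) z = (\<Prod>x\<in>#M. z - x)" by (induction M) (auto simp: left_diff_distrib)
    then show ?thesis using M(2) by (metis c_def poly_smult)
  qed
  define R where "R = {s. poly q (complex_of_real s) = 0}"
  have "finite R"
  proof -
    have "complex_of_real ` R \<subseteq> {z. poly q z = 0}" by (auto simp: R_def)
    then have "finite (complex_of_real ` R)" using poly_roots_finite[OF False] finite_subset by blast
    then show ?thesis by (rule finite_imageD) (auto simp: inj_on_def)
  qed
  then have R: "R \<in> null_sets lborel" by (rule finite_imp_null_set_lborel)
  have meas[measurable]: "(\<lambda>s. \<Sum>a\<in>#M. root_weight a s) \<in> borel_measurable borel"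
    by (induction M) auto
  have emA: "emeasure lborel (A - R) = emeasure lborel A"
    using A R by (intro emeasure_Diff_null_set) auto
  have "\<exists>s\<in>A - R. (\<Sum>a\<in>#M. root_weight a s) \<le> 25 * size M"
  proof (rule ccontr)
    assume "\<not> ?thesis"
    then have big: "(\<Sum>a\<in>#M. root_weight a s) > 25 * size M" if "s \<in> A - R" for s using that by force
    have "ennreal (25 * size M) * ennreal (1/4) \<le> ennreal (25 * size M) * emeasure lborel (A - R)"
      using A emA by (intro mult_left_mono) auto
    also have "\<dots> = (\<integral>\<^sup>+s. ennreal (25 * size M) * indicator (A - R) s \<partial>lborel)"
      using A R by (subst nn_integral_cmult_indicator) auto
    also have "\<dots> \<le> (\<integral>\<^sup>+s. ennreal (\<Sum>a\<in>#M. root_weight a s) * indicator {0..1} s \<partial>lborel)"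
    proof (rule nn_integral_mono)
      fix s :: real
      show "ennreal (25 * size M) * indicator (A - R) s \<le> ennreal (\<Sum>a\<in>#M. root_weight a s) * indicator {0..1} s"
      proof (cases "s \<in> A - R")
        case True
        then have "ennreal (25 * size M) \<le> ennreal (\<Sum>a\<in>#M. root_weight a s)"
          using big by (intro ennreal_leI less_imp_le) auto
        moreover have "s \<in> {0..1}" using True A(2) by auto
        ultimately show ?thesis using True by simp
      qed simp
    qed
    also have "\<dots> \<le> ennreal (6 * size M)"
      using nn_integral_sum_root_weight[of M] by (simp add: ennreal_of_nat_eq_real_of_nat)
    finally have "25 * real (size M) * (1/4) \<le> 6 * size M"
      by (subst (asm) ennreal_mult[symmetric]) (auto simp: ennreal_le_iff)
    then have "size M = 0" by linarith
    moreover have "A - R \<noteq> {}"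
    proof
      assume "A - R = {}"
      then have "emeasure lborel A = 0" using emA by (simp only: emeasure_empty)
      then show False using A(3) by simp
    qed
    ultimately show False using big by auto
  qed
  then obtain s where s: "s \<in> A" "s \<notin> R" "(\<Sum>a\<in>#M. root_weight a s) \<le> 25 * size M" by auto
  have nr: "complex_of_real s - x \<noteq> 0" if "x \<in># M" for x
    using s(2) that by (auto simp: R_def q)
  have "norm (\<Prod>x\<in>#M. 0 - x) = (\<Prod>x\<in>#M. root_weight x s)\<^sup>2 * norm (\<Prod>x\<in>#M. complex_of_real s - x)"
    using nr
  proof (induction M)
    case (add x M)
    have "norm x = (root_weight x s)\<^sup>2 * norm (complex_of_real s - x)"
      using add.prems[of x] by (simp add: root_weight_def)
    then show ?case using add by (simp add: norm_mult power_mult_distrib mult_ac)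
  qed auto
  then have "norm (poly q 0) = (\<Prod>x\<in>#M. root_weight x s)\<^sup>2 * norm (poly q (complex_of_real s))"
    by (simp add: q norm_mult)
  also have "\<dots> \<le> (25 ^ size M)\<^sup>2 * m"
    using s prod_le_power_of_sum_le[of "\<lambda>a. root_weight a s" 25 M] bound
    by (intro mult_mono power_mono) (auto simp: root_weight_nonneg prod_mset_nonneg)
  also have "(25 ^ size M)\<^sup>2 = (625::real) ^ size M" by (simp add: power2_eq_square flip: power_mult_distrib) 
  also have "625 ^ size M * m \<le> 625 ^ k * m"
    using deg M order_trans[OF norm_ge_zero bound[OF s(1)]] by (intro mult_right_mono power_increasing) auto
  finally show ?thesis .
qed

section \<open>Homogeneous parts of holomorphic functions\<close>

text \<open>What is left of vector-valued holomorphy after composition with a continuous complex linear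
  functional; on each line the one-variable theory applies.\<close>

definition slice_holomorphic :: "(complex ^ 'n \<Rightarrow> complex) \<Rightarrow> (complex ^ 'n) set \<Rightarrow> bool" where
  "slice_holomorphic h D \<longleftrightarrow> continuous_on D h \<and>
     (\<forall>z v. (\<lambda>t. h (z + t *s v)) holomorphic_on {t. z + t *s v \<in> D})"

text \<open>The homogeneous part of degree \<open>k\<close> of the Taylor expansion of \<open>h\<close> at \<open>0\<close>. Only the germ at \<open>0\<close> of
  the restriction of \<open>h\<close> to the line through \<open>z\<close> enters, so the definition makes sense for all \<open>z\<close>
  even if \<open>h\<close> is only meaningful on a ball.\<close>

definition hpart :: "(complex ^ 'n \<Rightarrow> complex) \<Rightarrow> nat \<Rightarrow> complex ^ 'n \<Rightarrow> complex" where
  "hpart h k z = (deriv ^^ k) (\<lambda>\<zeta>. h (\<zeta> *s z)) 0 / fact k"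

context
  fixes h :: "complex ^ 'n \<Rightarrow> complex"
  assumes h: "slice_holomorphic h (ball 0 1)"
begin

lemma slice_at_0:
  assumes "\<rho> * norm z \<le> 1"
  shows "(\<lambda>\<zeta>. h (\<zeta> *s z)) holomorphic_on ball 0 \<rho>"
proof -
  have "(\<lambda>t. h (0 + t *s z)) holomorphic_on {t. 0 + t *s z \<in> ball 0 1}"
    using h unfolding slice_holomorphic_def by blast
  moreover have "ball 0 \<rho> \<subseteq> {t. 0 + t *s z \<in> ball 0 1}"
  proof
    fix t :: complex assume t: "t \<in> ball 0 \<rho>"
    have "norm t * norm z < 1"
    proof (cases "z = 0")
      case False
      then have "norm t * norm z < \<rho> * norm z" using t by simp
      then show ?thesis using assms by simp
    qed simp
    then show "t \<in> {t. 0 + t *s z \<in> ball 0 1}" by (simp add: norm_smult)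
  qed
  ultimately show ?thesis using holomorphic_on_subset by auto
qed

lemma hpart_sums:
  assumes "\<rho> * norm z \<le> 1" "norm \<zeta> < \<rho>"
  shows "(\<lambda>k. hpart h k z * \<zeta> ^ k) sums h (\<zeta> *s z)"
  using holomorphic_power_series[OF slice_at_0[OF assms(1)], of \<zeta>] assms(2) by (simp add: hpart_def)

lemma hpart_norm_le:
  assumes "\<rho> * norm z < 1" "\<rho> > 0" "\<And>\<zeta>. norm \<zeta> = \<rho> \<Longrightarrow> norm (h (\<zeta> *s z)) \<le> M"
  shows "norm (hpart h k z) \<le> M / \<rho> ^ k"
proof -
  obtain R where R: "R > \<rho>" "R * norm z \<le> 1"
  proof (cases "z = 0")
    case False
    then show ?thesis using assms by (intro that[of "1 / norm z"]) (auto simp: field_simps)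
  qed (use that[of "\<rho> + 1"] in auto)
  have "continuous_on (ball 0 R) (\<lambda>\<zeta>. h (\<zeta> *s z))"
    by (rule holomorphic_on_imp_continuous_on[OF slice_at_0[OF R(2)]])
  then have "continuous_on (cball 0 \<rho>) (\<lambda>\<zeta>. h (\<zeta> *s z))"
    by (rule continuous_on_subset) (use R in auto)
  moreover have "(\<lambda>\<zeta>. h (\<zeta> *s z)) holomorphic_on ball 0 \<rho>" by (rule slice_at_0) (use assms in auto)
  ultimately have "norm ((deriv ^^ k) (\<lambda>\<zeta>. h (\<zeta> *s z)) 0) \<le> fact k * M / \<rho> ^ k"
    using assms by (intro Cauchy_inequality) auto
  then show ?thesis by (simp add: hpart_def norm_divide field_simps)
qed

lemma hpart_scale: "hpart h k (c *s z) = c ^ k * hpart h k z"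
proof -
  define R where "R = 1 / (1 + norm z)"
  have R: "R * norm z \<le> 1" "R > 0" by (auto simp: R_def field_simps add_nonneg_pos add_pos_nonneg)
  have "(deriv ^^ k) (\<lambda>w. (\<lambda>\<zeta>. h (\<zeta> *s z)) (c * w)) 0 = c ^ k * (deriv ^^ k) (\<lambda>\<zeta>. h (\<zeta> *s z)) (c * 0)"
  proof (rule higher_deriv_compose_linear[OF slice_at_0[OF R(1)]])
    show "open ((\<lambda>w. c * w) -` ball 0 R)"
      by (intro open_vimage continuous_intros) auto
  qed (use R in auto)
  then show ?thesis by (simp add: hpart_def vector_smult_assoc mult.commute)
qed

text \<open>By induction on \<open>k\<close>: as \<open>\<zeta>\<close> tends to \<open>0\<close>, the remainder
  \<open>(h (\<zeta> *s w) - (\<Sum>i<k. hpart h i w * \<zeta> ^ i)) / \<zeta> ^ k\<close> tends to \<open>hpart h k w\<close>, locally uniformly in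
  \<open>w\<close> by the Cauchy estimates.\<close>

lemma hpart_slice_holomorphic:
  assumes S: "open S" and \<rho>: "\<rho> > 0" "\<And>t. t \<in> S \<Longrightarrow> \<rho> * norm (z + t *s v) < 1"
  shows "(\<lambda>t. hpart h k (z + t *s v)) holomorphic_on S"
proof (induction k rule: less_induct)
  case (less k)
  define \<zeta> :: "nat \<Rightarrow> complex" where "\<zeta> m = complex_of_real (\<rho> / (m + 2))" for m
  have n\<zeta>: "norm (\<zeta> m) = \<rho> / (m + 2)" for m
    unfolding \<zeta>_def norm_of_real using \<rho>(1) by simp
  have nz: "\<zeta> m \<noteq> 0" for m
  proof -
    have "norm (\<zeta> m) > 0" unfolding n\<zeta> using \<rho>(1) by simp
    then show ?thesis by simp
  qed
  have l\<zeta>: "norm (\<zeta> m) < \<rho>" for m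
  proof -
    have "\<rho> / (real m + 2) < \<rho> / 1" using \<rho>(1) by (intro divide_strict_left_mono) auto
    then show ?thesis by (simp add: n\<zeta> add.commute)
  qed
  define F where "F m t = (h (\<zeta> m *s (z + t *s v)) - (\<Sum>i<k. hpart h i (z + t *s v) * \<zeta> m ^ i)) / \<zeta> m ^ k" for m t
  show ?case
  proof (rule holomorphic_uniform_sequence[OF S])
    fix m
    have "(\<lambda>t. h (\<zeta> m *s z + t *s (\<zeta> m *s v))) holomorphic_on S"
    proof (rule holomorphic_on_subset)
      show "(\<lambda>t. h (\<zeta> m *s z + t *s (\<zeta> m *s v))) holomorphic_on {t. \<zeta> m *s z + t *s (\<zeta> m *s v) \<in> ball 0 1}"
        using h unfolding slice_holomorphic_def by blast
      show "S \<subseteq> {t. \<zeta> m *s z + t *s (\<zeta> m *s v) \<in> ball 0 1}"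
      proof
        fix t assume "t \<in> S"
        have "\<zeta> m *s z + t *s (\<zeta> m *s v) = \<zeta> m *s (z + t *s v)"
          by (simp add: vec_eq_iff algebra_simps)
        then have "norm (\<zeta> m *s z + t *s (\<zeta> m *s v)) = norm (\<zeta> m) * norm (z + t *s v)"
          by (simp only: norm_smult)
        moreover have "norm (\<zeta> m) * norm (z + t *s v) \<le> \<rho> * norm (z + t *s v)"
          using l\<zeta>[of m] by (intro mult_right_mono) auto
        ultimately have "norm (\<zeta> m *s z + t *s (\<zeta> m *s v)) < 1"
          using \<rho>(2)[OF \<open>t \<in> S\<close>] by linarith
        then show "t \<in> {t. \<zeta> m *s z + t *s (\<zeta> m *s v) \<in> ball 0 1}"
          by (simp only: mem_Collect_eq mem_ball dist_0_norm)
      qed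
    qed
    moreover have "\<zeta> m *s z + t *s (\<zeta> m *s v) = \<zeta> m *s (z + t *s v)" for t
      by (simp add: vec_eq_iff algebra_simps)
    ultimately have H: "(\<lambda>t. h (\<zeta> m *s (z + t *s v))) holomorphic_on S" by (simp only:)
    show "F m holomorphic_on S"
      unfolding F_def
      by (intro holomorphic_on_divide holomorphic_on_diff H holomorphic_on_sum holomorphic_on_mult
          holomorphic_on_const less) (simp_all add: nz)
  next
    fix x assume "x \<in> S"
    then obtain d where d: "d > 0" "cball x d \<subseteq> S" using S unfolding open_contains_cball by blast
    have cpt: "compact ((\<lambda>p. h (fst p *s (z + snd p *s v))) ` (sphere 0 \<rho> \<times> cball x d))"
    proof (intro compact_continuous_image compact_Times compact_sphere compact_cball)
      have "continuous_on (ball 0 1) h" using h by (simp add: slice_holomorphic_def)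
      then show "continuous_on (sphere 0 \<rho> \<times> cball x d) (\<lambda>p. h (fst p *s (z + snd p *s v)))"
      proof (rule continuous_on_compose2)
        show "continuous_on (sphere 0 \<rho> \<times> cball x d) (\<lambda>p. fst p *s (z + snd p *s v))"
          unfolding vector_scalar_mult_def by (intro continuous_intros)
        show "(\<lambda>p. fst p *s (z + snd p *s v)) ` (sphere 0 \<rho> \<times> cball x d) \<subseteq> ball 0 1"
        proof (rule image_subsetI)
          fix p :: "complex \<times> complex" assume "p \<in> sphere 0 \<rho> \<times> cball x d"
          then have "norm (fst p) = \<rho>" "snd p \<in> S" using d(2) by auto
          then show "fst p *s (z + snd p *s v) \<in> ball 0 1"
            using \<rho>(2)[of "snd p"] by (simp only: mem_ball dist_0_norm norm_smult)
        qed
      qed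
    qed
    obtain M where M: "\<And>\<zeta> t. norm \<zeta> = \<rho> \<Longrightarrow> t \<in> cball x d \<Longrightarrow> norm (h (\<zeta> *s (z + t *s v))) \<le> M"
    proof -
      assume that: "\<And>M. (\<And>\<zeta> t. norm \<zeta> = \<rho> \<Longrightarrow> t \<in> cball x d \<Longrightarrow> norm (h (\<zeta> *s (z + t *s v))) \<le> M) \<Longrightarrow> thesis"
      obtain b where b: "\<forall>y\<in>(\<lambda>p. h (fst p *s (z + snd p *s v))) ` (sphere 0 \<rho> \<times> cball x d). norm y \<le> b"
        using compact_imp_bounded[OF cpt] unfolding bounded_iff by blast
      show thesis
      proof (rule that)
        fix \<zeta> t :: complex assume "norm \<zeta> = \<rho>" "t \<in> cball x d"
        then have "(\<zeta>, t) \<in> sphere 0 \<rho> \<times> cball x d" by simp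
        from bspec[OF b imageI[OF this]] show "norm (h (\<zeta> *s (z + t *s v))) \<le> b" by (simp only: fst_conv snd_conv)
      qed
    qed
    have P: "norm (hpart h i (z + t *s v)) \<le> M / \<rho> ^ i" if "t \<in> cball x d" for i t
      using \<rho> d that by (intro hpart_norm_le M) auto
    have M0: "M \<ge> 0"
    proof -
      have "norm (hpart h 0 (z + x *s v)) \<le> M" using P[of x 0] d(1) by simp
      then show ?thesis by (rule order_trans[OF norm_ge_zero])
    qed
    have est: "norm (F m t - hpart h k (z + t *s v)) \<le> M / \<rho> ^ k / (real m + 1)"
      if t: "t \<in> cball x d" for m t
    proof -
      let ?P = "\<lambda>i. hpart h i (z + t *s v)"
      define y where "y = 1 / (real m + 2)"
      have y: "y > 0" "y < 1" by (auto simp: y_def field_simps)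
      have "(\<lambda>i. ?P i * \<zeta> m ^ i) sums h (\<zeta> m *s (z + t *s v))"
        using \<rho>(2)[of t] t d(2) l\<zeta>[of m] by (intro hpart_sums[of \<rho>]) auto
      then have "(\<lambda>i. ?P (i + Suc k) * \<zeta> m ^ (i + Suc k)) sums
          (h (\<zeta> m *s (z + t *s v)) - (\<Sum>i<Suc k. ?P i * \<zeta> m ^ i))"
        by (rule sums_split_initial_segment)
      then have shifted: "(\<lambda>i. ?P (i + Suc k) * \<zeta> m ^ (i + Suc k) / \<zeta> m ^ k) sums
          ((h (\<zeta> m *s (z + t *s v)) - (\<Sum>i<Suc k. ?P i * \<zeta> m ^ i)) / \<zeta> m ^ k)"
        by (rule sums_divide)
      have *: "(\<lambda>i. ?P (i + Suc k) * \<zeta> m ^ Suc i) sums (F m t - ?P k)"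
      proof -
        have "?P (i + Suc k) * \<zeta> m ^ (i + Suc k) / \<zeta> m ^ k = ?P (i + Suc k) * \<zeta> m ^ Suc i" for i
          using nz[of m] by (simp add: power_add)
        moreover have "(h (\<zeta> m *s (z + t *s v)) - (\<Sum>i<Suc k. ?P i * \<zeta> m ^ i)) / \<zeta> m ^ k = F m t - ?P k"
          using nz[of m] by (simp only: F_def sum.lessThan_Suc) (simp add: diff_divide_distrib add_divide_distrib)
        ultimately show ?thesis using shifted by (simp only:)
      qed
      have "(\<lambda>i. y ^ i) sums (1 / (1 - y))" using y by (intro geometric_sums) auto
      then have "(\<lambda>i. M / \<rho> ^ k * y * y ^ i) sums (M / \<rho> ^ k * y * (1 / (1 - y)))" by (rule sums_mult)
      moreover have "norm (?P (i + Suc k) * \<zeta> m ^ Suc i) \<le> M / \<rho> ^ k * y * y ^ i" for i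
      proof -
        have "norm (?P (i + Suc k) * \<zeta> m ^ Suc i) \<le> M / \<rho> ^ (i + Suc k) * (\<rho> * y) ^ Suc i"
          unfolding norm_mult norm_power n\<zeta> using P[OF t, of "i + Suc k"]
          using \<rho>(1) M0 y(1) by (intro mult_mono power_mono) (auto simp: y_def add.commute)
        also have "\<dots> = M / \<rho> ^ k * y * y ^ i"
          using \<rho>(1) by (simp add: power_mult_distrib power_add)
        finally show ?thesis .
      qed
      ultimately have "norm (F m t - ?P k) \<le> M / \<rho> ^ k * y * (1 / (1 - y))"
        using norm_sums_le[OF *] by blast
      also have "M / \<rho> ^ k * y * (1 / (1 - y)) = M / \<rho> ^ k * (y * (1 / (1 - y)))" by (rule mult.assoc)
      also have "y * (1 / (1 - y)) = 1 / (real m + 1)" by (simp add: y_def field_simps)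
      also have "M / \<rho> ^ k * (1 / (real m + 1)) = M / \<rho> ^ k / (real m + 1)" by simp
      finally show ?thesis .
    qed
    have "uniform_limit (cball x d) F (\<lambda>t. hpart h k (z + t *s v)) sequentially"
    proof (rule uniform_limitI)
      fix e :: real assume e: "e > 0"
      have "(\<lambda>m. M / \<rho> ^ k / (real m + 1)) \<longlonglongrightarrow> 0"
        by real_asymp
      then have "eventually (\<lambda>m. M / \<rho> ^ k / (real m + 1) < e) sequentially"
        using e by (rule order_tendstoD)
      then show "eventually (\<lambda>m. \<forall>t\<in>cball x d. dist (F m t) (hpart h k (z + t *s v)) < e) sequentially"
      proof eventually_elim
        fix m assume "M / \<rho> ^ k / (real m + 1) < e"
        then show "\<forall>t\<in>cball x d. dist (F m t) (hpart h k (z + t *s v)) < e"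
          unfolding dist_norm by (intro ballI le_less_trans[OF est])
      qed
    qed
    then show "\<exists>d>0. cball x d \<subseteq> S \<and> uniform_limit (cball x d) F (\<lambda>t. hpart h k (z + t *s v)) sequentially"
      using d by blast
  qed
qed

text \<open>Along an affine line the homogeneous part is entire, and by homogeneity and boundedness of \<open>h\<close> near
  \<open>0\<close> it grows at most like the \<open>k\<close>-th power, so Liouville's theorem applies.\<close>

theorem hpart_polynomial_on_lines:
  obtains q where "degree q \<le> k" "\<And>t. poly q t = hpart h k (z + t *s v)"
proof -
  define F where "F t = hpart h k (z + t *s v)" for t
  have "F holomorphic_on UNIV"
    unfolding holomorphic_on_def
  proof
    fix t0 :: complex
    define \<rho> where "\<rho> = 1 / (1 + norm z + (norm t0 + 1) * norm v)"
    have \<rho>: "\<rho> > 0" by (simp add: \<rho>_def add_pos_nonneg)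
    have "F holomorphic_on ball t0 1"
      unfolding F_def
    proof (rule hpart_slice_holomorphic[OF _ \<rho>])
      fix t assume "t \<in> ball t0 1"
      then have "norm t \<le> norm t0 + 1" using norm_triangle_ineq2[of t t0] by (simp add: dist_norm norm_minus_commute)
      then have "norm t * norm v \<le> (norm t0 + 1) * norm v" by (intro mult_right_mono) auto
      then have "norm (z + t *s v) < 1 + norm z + (norm t0 + 1) * norm v"
        using norm_triangle_ineq[of z "t *s v"] by (simp add: norm_smult)
      then show "\<rho> * norm (z + t *s v) < 1"
        using \<rho> by (simp add: \<rho>_def divide_less_eq)
    qed auto
    then show "F field_differentiable at t0 within UNIV"
      by (simp add: holomorphic_on_imp_differentiable_at)
  qed
  obtain M where M: "\<And>w. w \<in> cball 0 (1/2) \<Longrightarrow> norm (h w) \<le> M"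
  proof -
    have "continuous_on (cball 0 (1/2)) h"
      using h unfolding slice_holomorphic_def by (auto intro: continuous_on_subset)
    then have "bounded (h ` cball 0 (1/2))" by (intro compact_imp_bounded compact_continuous_image) auto
    then obtain b where "\<forall>x\<in>h ` cball 0 (1/2). norm x \<le> b" unfolding bounded_iff by blast
    then show ?thesis by (intro that[of b]) blast
  qed
  have M0: "M \<ge> 0" using M[of 0] norm_ge_zero[of "h 0"] by (metis centre_in_cball order_trans zero_le_divide_1_iff zero_le_numeral)
  define B where "B = 2 * (1 + norm z + norm v)"
  have grow: "norm (F t) \<le> M * B ^ k * norm t ^ k" if t: "1 \<le> norm t" for t
  proof -
    define n where "n = norm (z + t *s v)"
    \<comment> \<open>With this radius the Cauchy estimate only sees \<open>h\<close> on the ball of radius \<open>1/2\<close>.\<close>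
    define \<rho> where "\<rho> = 1 / (2 * (1 + n))"
    have n: "n \<ge> 0" by (simp add: n_def)
    have \<rho>n: "\<rho> * n < 1/2" "\<rho> > 0" using n by (auto simp: \<rho>_def field_simps)
    have "norm (F t) \<le> M / \<rho> ^ k"
      unfolding F_def
    proof (rule hpart_norm_le)
      fix \<zeta> :: complex assume "norm \<zeta> = \<rho>"
      then have "norm (\<zeta> *s (z + t *s v)) = \<rho> * n" by (simp only: norm_smult n_def)
      then show "norm (h (\<zeta> *s (z + t *s v))) \<le> M"
        using \<rho>n by (intro M) (simp only: mem_cball dist_0_norm)
    qed (use \<rho>n in \<open>auto simp: n_def\<close>)
    also have "\<dots> = M * (2 * (1 + n)) ^ k" by (simp add: \<rho>_def power_divide)
    also have "\<dots> \<le> M * (B * norm t) ^ k"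
    proof (intro mult_left_mono power_mono M0)
      have "n \<le> norm z + norm t * norm v" using norm_triangle_ineq[of z "t *s v"] by (simp add: n_def norm_smult)
      moreover have "norm z \<le> norm z * norm t" using t by (simp add: mult_le_cancel_left1)
      ultimately show "2 * (1 + n) \<le> B * norm t" using t by (simp add: B_def algebra_simps)
    qed (use n in auto)
    finally show ?thesis by (simp add: power_mult_distrib)
  qed
  define q where "q = (\<Sum>i\<le>k. monom ((deriv ^^ i) F 0 / fact i) i)"
  have "poly q t = F t" for t
    using Liouville_polynomial[OF \<open>F holomorphic_on UNIV\<close> grow, where \<xi> = t] by (simp add: q_def poly_sum poly_monom)
  moreover have "degree q \<le> k"
    unfolding q_def by (rule degree_sum_le) (auto intro: order_trans[OF degree_monom_le])
  ultimately show ?thesis using that by (simp add: F_def)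
qed

end

section \<open>Bounds from large circled sets\<close>

lemma emeasure_lborel_affine:
  fixes X :: "'a::euclidean_space set"
  assumes "X \<in> sets borel" "c \<noteq> 0"
  shows "emeasure lborel X = ennreal (\<bar>c\<bar> ^ DIM('a)) * emeasure lborel ((\<lambda>x. t + c *\<^sub>R x) -` X)"
proof -
  have "emeasure lborel X = emeasure (density (distr lborel borel (\<lambda>x. t + c *\<^sub>R x)) (\<lambda>_. \<bar>c\<bar>^DIM('a))) X"
    using lborel_affine[OF assms(2), of t] by simp
  also have "\<dots> = ennreal (\<bar>c\<bar> ^ DIM('a)) * emeasure lborel ((\<lambda>x. t + c *\<^sub>R x) -` X)"
    using assms(1) by (simp add: emeasure_density nn_integral_cmult emeasure_distr)
  finally show ?thesis .
qed

text \<open>For fixed \<open>s\<close> between \<open>1/2\<close> and \<open>1\<close>, taking preimages under \<open>\<lambda>v. z + s *\<^sub>R v\<close> multiplies Lebesgue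
  measure by at most \<open>2 ^ DIM('a)\<close>. By Fubini's theorem some \<open>v\<close> in the ball of radius \<open>r/2\<close>
  then has at most measure \<open>1/4\<close> of parameters \<open>s\<close> with \<open>z + s *\<^sub>R v\<close> outside \<open>E\<close>. Keeping \<open>s\<close> away
  from \<open>0\<close> is what bounds this factor.\<close>

lemma real_line_meets_large_set:
  fixes E :: "'a::euclidean_space set"
  assumes r: "r > 0" and E: "E \<in> sets borel" and z: "norm z \<le> r / 2"
    and small: "emeasure lborel (cball 0 r - E) \<le> ennreal (measure lborel (cball (0::'a) (r/2)) / (4 * 2 ^ DIM('a)))"
  obtains v where "{s \<in> {1/2..1}. z + s *\<^sub>R v \<in> E} \<in> sets borel"
    "emeasure lborel {s \<in> {1/2..1}. z + s *\<^sub>R v \<in> E} \<ge> ennreal (1/4)"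
proof -
  define X where "X = cball 0 r - E"
  define V where "V = cball (0::'a) (r/2)"
  define b where "b = measure lborel V"
  have X[measurable]: "X \<in> sets borel" using E by (simp add: X_def)
  have V[measurable]: "V \<in> sets borel" by (simp add: V_def)
  have emV: "emeasure lborel V = ennreal b"
    using emeasure_lborel_cball_finite[of "0::'a" "r/2"]
    unfolding b_def by (intro emeasure_eq_ennreal_measure) (simp add: V_def less_top)
  have b: "b > 0" using r by (simp add: b_def V_def content_cball_pos)
  define B where "B v = {s \<in> {1/2..1}. z + s *\<^sub>R v \<in> X}" for v
  have Bm: "B v \<in> sets borel" for v
  proof -
    have "B v = {1/2..1} \<inter> (\<lambda>s. z + s *\<^sub>R v) -` X" by (auto simp: B_def)
    moreover have "(\<lambda>s. z + s *\<^sub>R v) -` X \<in> sets borel"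
      using measurable_sets[of "\<lambda>s. z + s *\<^sub>R v" borel borel X] by simp
    ultimately show ?thesis by auto
  qed
  let ?f = "\<lambda>v s. indicator V v * (indicator {1/2..1} s * indicator X (z + s *\<^sub>R v)) :: ennreal"
  have fm: "case_prod ?f \<in> borel_measurable (lborel \<Otimes>\<^sub>M lborel)"
    by (simp add: case_prod_beta') measurable
  have inner: "(\<integral>\<^sup>+s. ?f v s \<partial>lborel) = indicator V v * emeasure lborel (B v)" for v
  proof -
    have "(\<integral>\<^sup>+s. ?f v s \<partial>lborel) = (\<integral>\<^sup>+s. indicator V v * indicator (B v) s \<partial>lborel)"
      by (intro nn_integral_cong) (auto simp: B_def split: split_indicator)
    then show ?thesis using Bm by (simp add: nn_integral_cmult)
  qed
  have outer: "(\<integral>\<^sup>+v. ?f v s \<partial>lborel) \<le> ennreal (b / 4) * indicator {1/2..1} s" for s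
  proof (cases "s \<in> {1/2..1}")
    case True
    have "(\<integral>\<^sup>+v. ?f v s \<partial>lborel) \<le> (\<integral>\<^sup>+v. indicator ((\<lambda>v. z + s *\<^sub>R v) -` X) v \<partial>lborel)"
      by (intro nn_integral_mono) (auto split: split_indicator)
    also have "\<dots> = emeasure lborel ((\<lambda>v. z + s *\<^sub>R v) -` X)"
      using measurable_sets[of "\<lambda>v. z + s *\<^sub>R v" borel borel X] by (intro nn_integral_indicator) auto
    also have "\<dots> \<le> ennreal (b / 4)"
    proof -
      let ?e = "emeasure lborel ((\<lambda>v. z + s *\<^sub>R v) -` X)"
      have p: "(1/2) ^ DIM('a) \<le> \<bar>s\<bar> ^ DIM('a)" using True by (intro power_mono) auto
      have "ennreal ((1/2) ^ DIM('a)) * ?e \<le> ennreal (\<bar>s\<bar> ^ DIM('a)) * ?e"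
        using p by (intro mult_right_mono ennreal_leI) auto
      also have "\<dots> = emeasure lborel X" using True by (subst emeasure_lborel_affine[OF X, of s z]) auto
      also have "\<dots> \<le> ennreal (b / (4 * 2 ^ DIM('a)))" using small by (simp add: X_def b_def V_def)
      finally have "ennreal (2 ^ DIM('a)) * (ennreal ((1/2) ^ DIM('a)) * ?e) \<le> ennreal (2 ^ DIM('a)) * ennreal (b / (4 * 2 ^ DIM('a)))"
        by (rule mult_left_mono) simp
      moreover have "ennreal (2 ^ DIM('a)) * (ennreal ((1/2) ^ DIM('a)) * ?e) = ?e"
        by (simp add: ennreal_mult[symmetric] mult.assoc[symmetric] power_mult_distrib[symmetric])
      moreover have "ennreal (2 ^ DIM('a)) * ennreal (b / (4 * 2 ^ DIM('a))) = ennreal (b / 4)"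
        using b by (subst ennreal_mult[symmetric]) auto
      ultimately show ?thesis by simp
    qed
    finally show ?thesis using True by simp
  qed simp
  have "\<exists>v\<in>V. emeasure lborel (B v) \<le> ennreal (1/4)"
  proof (rule ccontr)
    assume "\<not> ?thesis"
    then have big: "ennreal (1/4) \<le> emeasure lborel (B v)" if "v \<in> V" for v using that by force
    have "ennreal (1/4) * ennreal b = (\<integral>\<^sup>+v. ennreal (1/4) * indicator V v \<partial>lborel)"
      by (simp add: nn_integral_cmult_indicator emV)
    also have "\<dots> \<le> (\<integral>\<^sup>+v. (\<integral>\<^sup>+s. ?f v s \<partial>lborel) \<partial>lborel)"
      unfolding inner by (intro nn_integral_mono) (auto split: split_indicator intro: big)
    also have "\<dots> = (\<integral>\<^sup>+s. (\<integral>\<^sup>+v. ?f v s \<partial>lborel) \<partial>lborel)"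
      by (rule lborel_pair.Fubini'[OF fm, symmetric])
    also have "\<dots> \<le> (\<integral>\<^sup>+s. ennreal (b / 4) * indicator {1/2..1::real} s \<partial>lborel)"
      by (intro nn_integral_mono outer)
    also have "\<dots> = ennreal (b / 4) * ennreal (1/2)"
      by (simp add: nn_integral_cmult_indicator)
    finally have "ennreal (1/4 * b) \<le> ennreal (b / 4 * (1/2))"
      by (subst (1 2) ennreal_mult) (use b in auto)
    then have "1/4 * b \<le> b / 4 * (1/2)" using b by (subst (asm) ennreal_le_iff) auto
    then show False using b by simp
  qed
  then obtain v where v: "v \<in> V" "emeasure lborel (B v) \<le> ennreal (1/4)" by blast
  have inball: "z + s *\<^sub>R v \<in> cball 0 r" if "s \<in> {1/2..1}" for s
  proof -
    have "norm (s *\<^sub>R v) \<le> 1 * (r / 2)" unfolding norm_scaleR using that v(1) r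
      by (intro mult_mono) (auto simp: V_def)
    then show ?thesis using norm_triangle_ineq[of z "s *\<^sub>R v"] z by simp
  qed
  have eq: "{s \<in> {1/2..1}. z + s *\<^sub>R v \<in> E} = {1/2..1} - B v"
    using inball by (auto simp: B_def X_def)
  have "ennreal (1/2) = emeasure lborel {1/2..1::real}" by simp
  also have "\<dots> \<le> emeasure lborel (({1/2..1} - B v) \<union> B v)"
    using Bm by (intro emeasure_mono) auto
  also have "\<dots> \<le> emeasure lborel ({1/2..1} - B v) + emeasure lborel (B v)"
    using Bm by (intro emeasure_subadditive) auto
  also have "\<dots> \<le> emeasure lborel ({1/2..1} - B v) + ennreal (1/4)" using v by (intro add_left_mono)
  finally have "ennreal (1/2) - ennreal (1/4) \<le> emeasure lborel ({1/2..1} - B v)"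
    by (simp add: ennreal_minus_le_iff add.commute)
  then have "ennreal (1/4) \<le> emeasure lborel ({1/2..1} - B v)"
    by (subst (asm) ennreal_minus) auto
  then show ?thesis using that[of v] Bm unfolding eq by auto
qed

text \<open>The Cauchy estimates bound every homogeneous part by \<open>1\<close> on \<open>E\<close>. On a real line from a given point
  that meets \<open>E\<close> in a large set, the Remez inequality turns this into the bound \<open>625 ^ k\<close> at the point.
  Shrinking by \<open>1250\<close> and using homogeneity gives \<open>(1/2) ^ k\<close>, and the sum of the geometric series is
  \<open>2\<close>. It matters that the radius and the admissible size of the complement of \<open>E\<close> depend neither on \<open>h\<close>
  nor on \<open>E\<close>.\<close>

theorem bounded_near_zero_of_bounded_on_large_circled_set:
  fixes h :: "complex ^ 'n \<Rightarrow> complex"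
  assumes r: "0 < r" "r < 1" and h: "slice_holomorphic h (ball 0 1)"
    and E: "E \<in> sets borel" "E \<subseteq> cball 0 r"
    and small: "emeasure lborel (cball 0 r - E)
      \<le> ennreal (measure lborel (cball (0::complex ^ 'n) (r/2)) / (4 * 2 ^ DIM(complex ^ 'n)))"
    and bound: "\<And>z \<zeta>. z \<in> E \<Longrightarrow> norm \<zeta> \<le> 1 \<Longrightarrow> norm (h (\<zeta> *s z)) \<le> 1"
    and z: "norm z \<le> r / 2500"
  shows "norm (h z) \<le> 2"
proof -
  have P: "norm (hpart h k w) \<le> 1" if "w \<in> E" for k w
    using hpart_norm_le[OF h, of 1 w 1 k] bound[OF that] E(2) that r by fastforce
  have Q: "norm (hpart h k w) \<le> 625 ^ k" if w: "norm w \<le> r / 2" for k w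
  proof -
    obtain v where v: "{s \<in> {1/2..1}. w + s *\<^sub>R v \<in> E} \<in> sets borel"
      "emeasure lborel {s \<in> {1/2..1}. w + s *\<^sub>R v \<in> E} \<ge> ennreal (1/4)"
      by (rule real_line_meets_large_set[OF r(1) E(1) w small])
    obtain q where q: "degree q \<le> k" "\<And>t. poly q t = hpart h k (w + t *s v)"
      using hpart_polynomial_on_lines[OF h] by metis
    have "norm (poly q 0) \<le> 625 ^ k * 1"
      by (rule Remez_at_zero[OF q(1) v(1) _ v(2)]) (auto simp: q(2) smult_of_real P)
    then show ?thesis by (simp add: q(2))
  qed
  have R: "norm (hpart h k z * 1 ^ k) \<le> (1/2) ^ k" for k
  proof -
    have "norm (hpart h k (1250 *s z)) \<le> 625 ^ k" using z by (intro Q) (simp add: norm_smult)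
    then have "1250 ^ k * norm (hpart h k z) \<le> 625 ^ k"
      by (simp add: hpart_scale[OF h] norm_mult norm_power)
    then have "norm (hpart h k z) \<le> 625 ^ k / 1250 ^ k" by (simp add: field_simps)
    also have "\<dots> = (1/2) ^ k" by (simp flip: power_divide)
    finally show ?thesis by simp
  qed
  have "(\<lambda>k. hpart h k z * 1 ^ k) sums h (1 *s z)"
  proof (rule hpart_sums[OF h, of 2])
    show "2 * norm z \<le> 1" using z r by simp
  qed simp
  moreover have "(\<lambda>k. (1/2::real) ^ k) sums (1 / (1 - 1/2))" by (rule geometric_sums) simp
  ultimately have "norm (h (1 *s z)) \<le> 1 / (1 - 1/2)" using R by (rule norm_sums_le)
  then show ?thesis by simp
qed

section \<open>Convergence near the origin\<close>

lemma slice_holomorphic_functional: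
  fixes f :: "complex ^ 'n \<Rightarrow> 'f::frechet_space"
  assumes f: "f vholomorphic_on D" and D: "open D" and \<phi>: "clinear_functional \<phi>" "continuous_on UNIV \<phi>"
  shows "slice_holomorphic (\<lambda>z. \<phi> (f z)) D"
  unfolding slice_holomorphic_def
proof (intro conjI allI)
  show "continuous_on D (\<lambda>z. \<phi> (f z))"
    using f \<phi>(2) unfolding vholomorphic_on_def by (auto intro: continuous_on_compose2)
  fix z v
  have op: "open {t. z + t *s v \<in> D}"
    using D by (rule open_vimage[of D "\<lambda>t. z + t *s v", unfolded vimage_def])
      (auto intro!: continuous_intros continuous_on_smult)
  show "(\<lambda>t. \<phi> (f (z + t *s v))) holomorphic_on {t. z + t *s v \<in> D}"
    unfolding holomorphic_on_open[OF op]
  proof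
    fix t assume t: "t \<in> {t. z + t *s v \<in> D}"
    then obtain d where d: "((\<lambda>s. inverse s *\<^sub>C (f (z + t *s v + s *s v) - f (z + t *s v))) \<longlongrightarrow> d) (at 0)"
      using f unfolding vholomorphic_on_def by blast
    have "((\<lambda>s. \<phi> (inverse s *\<^sub>C (f (z + t *s v + s *s v) - f (z + t *s v)))) \<longlongrightarrow> \<phi> d) (at 0)"
      by (rule continuous_on_tendsto_compose[OF \<phi>(2) d]) auto
    moreover have "\<phi> (inverse s *\<^sub>C (f (z + t *s v + s *s v) - f (z + t *s v)))
      = (\<phi> (f (z + (t + s) *s v)) - \<phi> (f (z + t *s v))) / s" for s
    proof -
      have eq: "z + t *s v + s *s v = z + (t + s) *s v" by (simp add: vec_eq_iff algebra_simps)
      have sc: "\<phi> (c *\<^sub>C x) = c * \<phi> x" for c x using \<phi>(1) by (simp add: clinear_functional_def)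
      show ?thesis unfolding eq sc clinear_functional_diff[OF \<phi>(1)] divide_inverse by (rule mult.commute)
    qed
    ultimately show "\<exists>f'. ((\<lambda>t. \<phi> (f (z + t *s v))) has_field_derivative f') (at t)"
      unfolding DERIV_def by auto
  qed
qed

lemma slice_holomorphic_diff:
  "slice_holomorphic g D \<Longrightarrow> slice_holomorphic h D \<Longrightarrow> slice_holomorphic (\<lambda>z. g z - h z) D"
  unfolding slice_holomorphic_def by (auto intro!: continuous_on_diff holomorphic_on_diff)

lemma compact_disc_in_line: "compact ((\<lambda>\<zeta>. \<zeta> *s (z :: complex ^ 'n)) ` cball 0 1)"
  by (intro compact_continuous_image continuous_on_smult continuous_intros compact_cball)

lemma eventually_small_on_convergent_line:
  fixes f :: "nat \<Rightarrow> complex ^ 'n \<Rightarrow> 'f::frechet_space"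
  assumes conv: "convergent_uniformly_on_compacts f {w \<in> cline z. norm w < r0}"
    and z: "norm z < r0" and W: "open W" "0 \<in> W"
  shows "\<exists>N. \<forall>\<alpha>\<ge>N. \<forall>\<beta>\<ge>N. \<forall>\<zeta>\<in>cball 0 1. f \<alpha> (\<zeta> *s z) - f \<beta> (\<zeta> *s z) \<in> W"
proof -
  obtain D0 where D0: "eventually D0 uniformity" "\<And>x y. D0 (x, y) \<Longrightarrow> x - y \<in> W"
    using entourage_of_neighbourhood[OF W] by blast
  obtain D where D: "eventually D uniformity" "\<And>x y z. D (x, y) \<Longrightarrow> D (y, z) \<Longrightarrow> D0 (x, z)"
    using uniformity_transE[OF D0(1)] by blast
  define D' where "D' p \<longleftrightarrow> D p \<and> (case p of (x, y) \<Rightarrow> D (y, x))" for p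
  have D': "eventually D' uniformity"
    unfolding D'_def using uniformity_sym[OF D(1)] by (intro eventually_conj D(1)) 
  let ?K = "(\<lambda>\<zeta>. \<zeta> *s z) ` cball 0 1"
  have K: "?K \<subseteq> {w \<in> cline z. norm w < r0}"
  proof clarsimp
    fix \<zeta> :: complex assume "norm \<zeta> \<le> 1"
    then have "norm \<zeta> * norm z \<le> 1 * norm z" by (intro mult_right_mono) auto
    moreover have "\<zeta> *s z \<in> cline z" unfolding cline_def by (rule rangeI)
    ultimately show "\<zeta> *s z \<in> cline z \<and> norm (\<zeta> *s z) < r0" using z by (simp add: norm_smult)
  qed
  obtain g where g: "\<forall>\<^sub>F k in sequentially. \<forall>w\<in>?K. D' (f k w, g w)"
    using conv compact_disc_in_line[of z] K D' unfolding convergent_uniformly_on_compacts_def by blast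
  then obtain N where N: "\<And>k w. k \<ge> N \<Longrightarrow> w \<in> ?K \<Longrightarrow> D' (f k w, g w)"
    unfolding eventually_sequentially by blast
  have "f \<alpha> w - f \<beta> w \<in> W" if "\<alpha> \<ge> N" "\<beta> \<ge> N" "w \<in> ?K" for \<alpha> \<beta> w
    using N[OF that(1,3)] N[OF that(2,3)] D0(2) D(2) unfolding D'_def by blast
  then show ?thesis by blast
qed

lemma large_member_of_increasing_exhaustion:
  fixes E :: "nat \<Rightarrow> 'a::euclidean_space set"
  assumes "\<And>N. closed (E N)" "incseq E" "negligible (cball 0 r - (\<Union>N. E N))" "\<delta> > 0"
  shows "\<exists>N. emeasure lborel (cball 0 r - E N) \<le> ennreal \<delta>"
proof -
  let ?A = "\<lambda>N. cball 0 r - E N"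
  have s: "?A N \<in> sets lborel" for N using assms(1) by (auto intro!: sets.Diff borel_closed)
  have "(\<lambda>N. emeasure lborel (?A N)) \<longlonglongrightarrow> emeasure lborel (\<Inter>N. ?A N)"
  proof (rule Lim_emeasure_decseq)
    show "decseq ?A" using assms(2) by (auto simp: decseq_def incseq_def)
    fix N
    have "emeasure lborel (?A N) \<le> emeasure lborel (cball (0::'a) r)" by (intro emeasure_mono) auto
    then show "emeasure lborel (?A N) \<noteq> \<infinity>" using emeasure_lborel_cball_finite[of "0::'a" r] by (auto simp: top_unique)
  qed (use s in auto)
  moreover have "emeasure lborel (\<Inter>N. ?A N) = 0"
  proof -
    have sI: "(\<Inter>N. ?A N) \<in> sets lborel" using s by (intro sets.countable_INT) auto
    have "(\<Inter>N. ?A N) = cball 0 r - (\<Union>N. E N)" by auto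
    then have "negligible (\<Inter>N. ?A N)" using assms(3) by simp
    then have "emeasure lebesgue (\<Inter>N. ?A N) = 0"
      using sI by (subst (asm) negligible_iff_emeasure0) auto
    then show ?thesis using sI by simp
  qed
  ultimately have "(\<lambda>N. emeasure lborel (?A N)) \<longlonglongrightarrow> 0" by simp
  then have "eventually (\<lambda>N. emeasure lborel (?A N) < ennreal \<delta>) sequentially"
    using assms(4) by (intro order_tendstoD) auto
  then show ?thesis by (auto simp: eventually_sequentially intro: less_imp_le)
qed

text \<open>An Egorov argument. The sets \<open>E N\<close> of points on whose disc all functionals in \<open>\<Phi>\<close> are at most \<open>1\<close>
  in modulus on the differences \<open>f \<alpha> - f \<beta>\<close>, for \<open>\<alpha>\<close> and \<open>\<beta>\<close> beyond \<open>N\<close>, increase to a set of full measure, by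
  the convergence on almost every line. So some \<open>E N\<close> is large enough for the preceding estimate, which
  bounds the functionals by \<open>2\<close> on a ball that does not depend on \<open>U\<close>.\<close>

lemma uniformly_small_near_zero:
  fixes f :: "nat \<Rightarrow> complex ^ 'n \<Rightarrow> 'f::frechet_space"
  assumes f: "\<And>\<alpha>. \<alpha> \<ge> 1 \<Longrightarrow> f \<alpha> vholomorphic_on ball 0 1"
    and r: "0 < r" "r < r0" "r < 1"
    and null: "negligible X"
    and conv: "\<And>z. z \<notin> X \<Longrightarrow> convergent_uniformly_on_compacts f {w \<in> cline z. norm w < r0}"
    and U: "open U" "0 \<in> U"
  shows "\<exists>N. \<forall>\<alpha>\<ge>N. \<forall>\<beta>\<ge>N. \<forall>z\<in>ball 0 (r / 2500). f \<alpha> z - f \<beta> z \<in> U"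
proof -
  obtain \<Phi> W where \<Phi>: "\<And>\<phi>. \<phi> \<in> \<Phi> \<Longrightarrow> clinear_functional \<phi>"
    and W: "open W" "0 \<in> W" and \<Phi>W: "\<And>\<phi> y. \<phi> \<in> \<Phi> \<Longrightarrow> y \<in> W \<Longrightarrow> norm (\<phi> y) \<le> 1"
    and \<Phi>U: "\<And>y. (\<And>\<phi>. \<phi> \<in> \<Phi> \<Longrightarrow> norm (\<phi> y) \<le> 2) \<Longrightarrow> y \<in> U"
    by (rule neighbourhood_polar[OF U]) blast
  define h where "h \<phi> \<alpha> \<beta> z = \<phi> (f \<alpha> z) - \<phi> (f \<beta> z)" for \<phi> :: "'f \<Rightarrow> complex" and \<alpha> \<beta> z
  have h: "slice_holomorphic (h \<phi> \<alpha> \<beta>) (ball 0 1)" if "\<phi> \<in> \<Phi>" "\<alpha> \<ge> 1" "\<beta> \<ge> 1" for \<phi> \<alpha> \<beta>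
    unfolding h_def using that continuous_clinear_functional[OF \<Phi> W \<Phi>W]
    by (intro slice_holomorphic_diff slice_holomorphic_functional f \<Phi>) auto
  \<comment> \<open>The indices start at \<open>Suc N\<close> because \<open>f 0\<close> is arbitrary.\<close>
  define E where "E N = {z \<in> cball 0 r. \<forall>\<alpha>\<in>{Suc N..}. \<forall>\<beta>\<in>{Suc N..}. \<forall>\<zeta>\<in>cball 0 1. \<forall>\<phi>\<in>\<Phi>.
      norm (h \<phi> \<alpha> \<beta> (\<zeta> *s z)) \<le> 1}" for N
  have "closed (E N)" for N
  proof -
    have "closed {z \<in> cball 0 r. norm (h \<phi> \<alpha> \<beta> (\<zeta> *s z)) \<le> 1}"
      if that: "\<alpha> \<in> {Suc N..}" "\<beta> \<in> {Suc N..}" "\<zeta> \<in> cball 0 1" "\<phi> \<in> \<Phi>" for \<alpha> \<beta> \<zeta> \<phi>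
    proof (intro continuous_on_closed_Collect_le continuous_on_norm continuous_on_const closed_cball)
      have "continuous_on (ball 0 1) (h \<phi> \<alpha> \<beta>)" using h[of \<phi> \<alpha> \<beta>] that by (simp add: slice_holomorphic_def)
      then show "continuous_on (cball 0 r) (\<lambda>z. h \<phi> \<alpha> \<beta> (\<zeta> *s z))"
      proof (rule continuous_on_compose2)
        show "(\<lambda>z :: complex ^ 'n. \<zeta> *s z) ` cball 0 r \<subseteq> ball 0 1"
        proof (rule image_subsetI)
          fix z :: "complex ^ 'n" assume "z \<in> cball 0 r"
          then have "norm \<zeta> * norm z \<le> 1 * r" using that(3) r by (intro mult_mono) auto
          then show "\<zeta> *s z \<in> ball 0 1" using r by (simp add: norm_smult)
        qed
      qed (intro continuous_on_smult continuous_intros)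
    qed
    moreover have "E N = cball 0 r \<inter> (\<Inter>\<alpha>\<in>{Suc N..}. \<Inter>\<beta>\<in>{Suc N..}. \<Inter>\<zeta>\<in>cball 0 1. \<Inter>\<phi>\<in>\<Phi>.
        {z \<in> cball 0 r. norm (h \<phi> \<alpha> \<beta> (\<zeta> *s z)) \<le> 1})"
      unfolding E_def by blast
    ultimately show ?thesis by (auto intro!: closed_Int closed_INT)
  qed
  moreover have "incseq E" unfolding incseq_def E_def by fastforce
  moreover have "cball 0 r - (\<Union>N. E N) \<subseteq> X"
  proof (rule ccontr)
    assume "\<not> ?thesis"
    then obtain z where z: "z \<in> cball 0 r" "z \<notin> (\<Union>N. E N)" "z \<notin> X" by blast
    have "norm z < r0" using z(1) r by simp
    then obtain N where N: "\<And>\<alpha> \<beta> \<zeta>. \<alpha> \<ge> N \<Longrightarrow> \<beta> \<ge> N \<Longrightarrow> \<zeta> \<in> cball 0 1 \<Longrightarrow> f \<alpha> (\<zeta> *s z) - f \<beta> (\<zeta> *s z) \<in> W"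
      using eventually_small_on_convergent_line[OF conv[OF z(3)] _ W] by blast
    have "norm (h \<phi> \<alpha> \<beta> (\<zeta> *s z)) \<le> 1" if "\<alpha> \<ge> Suc N" "\<beta> \<ge> Suc N" "\<zeta> \<in> cball 0 1" "\<phi> \<in> \<Phi>" for \<alpha> \<beta> \<zeta> \<phi>
      using \<Phi>W[OF that(4) N[OF _ _ that(3)], of \<alpha> \<beta>] that
      unfolding h_def by (simp add: clinear_functional_diff[OF \<Phi>])
    then have "z \<in> E N" using z(1) unfolding E_def by auto
    then show False using z(2) by blast
  qed
  then have "negligible (cball 0 r - (\<Union>N. E N))" using null negligible_subset by blast
  moreover define \<delta> where "\<delta> = measure lborel (cball (0::complex ^ 'n) (r/2)) / (4 * 2 ^ DIM(complex ^ 'n))"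
  moreover have "\<delta> > 0" unfolding \<delta>_def using r content_cball_pos[of "r/2" "0::complex^'n"]
    by (intro divide_pos_pos) auto
  ultimately obtain N where N: "emeasure lborel (cball 0 r - E N) \<le> ennreal \<delta>" and cl: "closed (E N)"
    using large_member_of_increasing_exhaustion[of E r \<delta>] by blast
  have "f \<alpha> z - f \<beta> z \<in> U" if "\<alpha> \<ge> Suc N" "\<beta> \<ge> Suc N" "z \<in> ball 0 (r / 2500)" for \<alpha> \<beta> z
  proof (rule \<Phi>U)
    fix \<phi> assume \<phi>: "\<phi> \<in> \<Phi>"
    have "norm (h \<phi> \<alpha> \<beta> z) \<le> 2"
    proof (rule bounded_near_zero_of_bounded_on_large_circled_set[OF r(1,3)])
      show "slice_holomorphic (h \<phi> \<alpha> \<beta>) (ball 0 1)" using that \<phi> by (intro h) auto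
      show "E N \<in> sets borel" using cl by auto
      show "E N \<subseteq> cball 0 r" by (auto simp: E_def)
      show "norm (h \<phi> \<alpha> \<beta> (\<zeta> *s w)) \<le> 1" if "w \<in> E N" "norm \<zeta> \<le> 1" for w \<zeta>
        using that \<phi> \<open>\<alpha> \<ge> Suc N\<close> \<open>\<beta> \<ge> Suc N\<close> by (auto simp: E_def)
    qed (use N that in \<open>auto simp: \<delta>_def\<close>)
    then show "norm (\<phi> (f \<alpha> z - f \<beta> z)) \<le> 2" by (simp add: h_def clinear_functional_diff[OF \<Phi>[OF \<phi>]])
  qed
  then show ?thesis by blast
qed

theorem theorem4p1:
  fixes f :: "nat \<Rightarrow> complex ^ 'n \<Rightarrow> 'f::frechet_space"
    and B :: "(complex ^ 'n) set"
    and \<nu> :: "'n cproj measure"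
    and r0 :: real
  assumes "\<And>\<alpha>. \<alpha> \<ge> 1 \<Longrightarrow> f \<alpha> vholomorphic_on ball 0 1"
    and "B \<subseteq> ball 0 1"
    and "cproj_invariant_measure \<nu>"
    and "cproj_of ` (B - {0}) \<in> null_sets (completion \<nu>)"
    and "0 < r0" and "r0 < 1"
    and "\<And>l :: 'n cproj. Rep_cproj l \<inter> B \<subseteq> {0} \<Longrightarrow>
           convergent_uniformly_on_compacts f {z \<in> Rep_cproj l. norm z < r0}"
  shows "\<exists>U. open U \<and> 0 \<in> U \<and> U \<subseteq> ball 0 1 \<and> convergent_uniformly_on_compacts f U"
proof -
  obtain N where N: "N \<in> null_sets \<nu>" "cproj_of ` (B - {0}) \<subseteq> N"
    using assms(4) unfolding null_sets_completion_iff2 by blast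
  define X where "X = insert 0 {z. z \<noteq> 0 \<and> cproj_of z \<in> N}"
  have X: "negligible X"
    unfolding X_def using null_cone_of_invariant_null[OF assms(3) N(1)] by simp
  have conv: "convergent_uniformly_on_compacts f {w \<in> cline z. norm w < r0}" if "z \<notin> X" for z
  proof -
    have z: "z \<noteq> 0" "cproj_of z \<notin> N" using that by (auto simp: X_def)
    have "cline z \<inter> B \<subseteq> {0}"
    proof
      fix b assume b: "b \<in> cline z \<inter> B"
      show "b \<in> {0}"
      proof (rule ccontr)
        assume "b \<notin> {0}"
        then have "cproj_of b \<in> N" using b N(2) by blast
        moreover obtain c where "b = c *s z" using b by (auto simp: cline_def)
        moreover have "c \<noteq> 0" using \<open>b = c *s z\<close> \<open>b \<notin> {0}\<close> by auto
        ultimately show False using z(2) by (simp add: cproj_of_scale)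
      qed
    qed
    then show ?thesis using assms(7)[of "cproj_of z"] by (simp add: Rep_cproj_of[OF z(1)])
  qed
  define r where "r = r0 / 2"
  have r: "0 < r" "r < r0" "r < 1" using assms(5,6) by (auto simp: r_def)
  have "convergent_uniformly_on_compacts f (ball 0 (r / 2500))"
  proof (rule uniformly_Cauchy_imp_convergent_uniformly_on_compacts)
    fix D :: "'f \<times> 'f \<Rightarrow> bool" assume "eventually D uniformity"
    then obtain U where U: "open U" "0 \<in> U" "\<And>x y. x - y \<in> U \<Longrightarrow> D (y, x)"
      using neighbourhood_of_entourage by blast
    obtain M where "\<And>\<alpha> \<beta> z. \<alpha> \<ge> M \<Longrightarrow> \<beta> \<ge> M \<Longrightarrow> z \<in> ball 0 (r / 2500) \<Longrightarrow> f \<alpha> z - f \<beta> z \<in> U"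
      using uniformly_small_near_zero[OF assms(1) r X conv U(1,2)] by blast
    then show "\<exists>M. \<forall>\<alpha>\<ge>M. \<forall>\<beta>\<ge>M. \<forall>z\<in>ball 0 (r / 2500). D (f \<alpha> z, f \<beta> z)"
      using U(3) by blast
  qed
  then show ?thesis using r by (intro exI[of _ "ball 0 (r / 2500)"]) auto
qed

end
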